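(* (Conjunctivity of the $\star$-translation.) For every type-variable context $\Delta$ and any term $e$ and computational type $C$ of the language $\mathrm{DM}$: $\Delta\mid\cdot\vdash e:C\,!\,n$ implies $\underline\Delta\models\mathbb C_{C^\star}(e^\star)$.
   Context: **The language $\mathrm{DM}$.** Effects $\epsilon\in\{n,\tau\}$ ($n$ non-effectful, $\tau$ an abstract monad). Types: $A::=X\mid b\mid A\xrightarrow{n}A\mid A+A\mid A\times A$; $H::=A\mid C$; $C::=H\xrightarrow{\tau}A\mid H\xrightarrow{n}C\mid C\times C$, where $X$ ranges over type variables and $b$ over base types. Terms: $e::=x\mid e\,e\mid\lambda x{:}H.e\mid\kappa(e,\dots,e)\mid(e,e)\mid\mathbf{fst}(e)\mid\mathbf{snd}(e)\mid\mathbf{inl}(e)\mid\mathbf{inr}(e)\mid\mathbf{case}\,e\,\mathbf{inl}\,x{:}A.e;\mathbf{inr}\,y{:}A.e\mid\mathbf{return}_\tau\,e\mid\mathbf{bind}_\tau\,e\,\mathbf{to}\,x\,\mathbf{in}\,e$, with $\kappa$ constants. Judgments are $\Delta\mid\Gamma\vdash e:H\,!\,n$ and $\Delta\mid\Gamma\vdash e:A\,!\,\tau$; $\Delta$ is a finite sequence of type variables, $\Gamma$ a list of bindings $x{:}H$ with distinct variables and types over $\Delta$ ($\cdot$ is the empty list). All types appearing in rules must be well formed by the grammar. Rules: variables ($x{:}H\in\Gamma$ gives $x:H!n$); constants ($\kappa:b_1,\dots,b_n\to b$ and $e_i:b_i!n$ give $\kappa(e_1,\dots,e_n):b!n$); $\Gamma,x{:}H\vdash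 e:H'!\epsilon$ gives $\lambda x{:}H.e:H\xrightarrow{\epsilon}H'\,!\,n$; $f:H\xrightarrow{\epsilon}H'!n$ and $e:H!n$ give $f\,e:H'!\epsilon$; $e:H!n$, $e':H'!n$ give $(e,e'):H\times H'!n$; projections from $e:H\times H'!n$ have effect $n$; $e:A!n$ gives $\mathbf{inl}(e):A+A'!n$ (similarly $\mathbf{inr}$); $e:A+A'!n$, $\Gamma,x{:}A\vdash e_1:H!\epsilon$, $\Gamma,y{:}A'\vdash e_2:H!\epsilon$ give $\mathbf{case}\,e\,\mathbf{inl}\,x{:}A.e_1;\mathbf{inr}\,y{:}A'.e_2:H!\epsilon$; $e:A!n$ gives $\mathbf{return}_\tau\,e:A!\tau$; $e_1:A!\tau$ and $\Gamma,x{:}A\vdash e_2:A'!\tau$ give $\mathbf{bind}_\tau\,e_1\,\mathbf{to}\,x\,\mathbf{in}\,e_2:A'!\tau$. **The $\star$-translation** into $\mathrm{EMF}^\star$. On types: $A^\star$ is $A$ with every $\xrightarrow{n}$ replaced by $\to$; $(H\xrightarrow{n}C)^\star=H^\star\to C^\star$; $(C\times C')^\star=C^\star\times C'^\star$; $(H\xrightarrow{\tau}A)^\star=H^\star\to(A^\star\to\mathsf{Type}_0)\to\mathsf{Type}_0$. On terms (defined over typing derivations): $(\mathbf{return}_\tau\,e)^\star=\lambda p{:}(A^\star\to\mathsf{Type}_0).\,p\,e^\star$ when $e:A!n$; $(\mathbf{bind}_\tau\,e_1\,\mathbf{to}\,x\,\mathbf{in}\,e_2)^\star=\lambda p{:}(A'^\star\to\mathsf{Type}_0).\,e_1^\star\,(\lambda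 x{:}A^\star.\,e_2^\star\,p)$ when $e_1:A!\tau$, $e_2:A'!\tau$; all other constructs homomorphically ($(\lambda x{:}H.e)^\star=\lambda x{:}H^\star.e^\star$, etc.). If $\Delta=X_1,\dots,X_m$ then $\underline\Delta=X_1{:}\mathsf{Type}_0,\dots,X_m{:}\mathsf{Type}_0$. **Target and validity.** $\mathrm{EMF}^\star$ is a dependently typed $\lambda$-calculus with predicative universes $\mathsf{Type}_0:\mathsf{Type}_1:\cdots$; only its total fragment (functions, pairs, sums with case analysis, base types and constants of $\mathrm{DM}$) matters here. Formulas are terms of type $\mathsf{Type}_0$, with squashed (proof-irrelevant) connectives. $\Gamma\models\phi$ is $\mathrm{EMF}^\star$'s validity judgment: a proof-irrelevant classical higher-order logic with the usual rules for hypotheses, $\wedge,\vee,\Rightarrow,\forall,\exists$, propositional equality $=$ (reflexive, substitutive, containing $\beta\eta$-reduction, extensional on functions) and case analysis on sums. **Conjunctivity $\mathbb C$.** A non-dependent total type is predicate-free if it does not mention $\mathsf{Type}_0$; let $a$ range over predicate-free types (including type variables). The formula $\mathbb C_t(x)$ is defined, on a class of types including all $H^\star$, by: - $\mathbb C_{(a\to\mathsf{Type}_0)\to\mathsf{Type}_0}(w)$ is $\forall p_1,p_2.\ (w\,p_1\wedge w\,p_2)=w\,(\lambda x.\,p_1\,x\wedge p_2\,x)$; - $\mathbb C_a(x)$ is $\mathsf{true}$; - $\mathbb C_{t_1\to t_2}(f)$ is $\forall x{:}t_1.\ \mathbb C_{t_1}(x)\Rightarrow\mathbb C_{t_2}(f\,x)$;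 - $\mathbb C_{t_1\times t_2}(p)$ is $\mathbb C_{t_1}(\mathsf{fst}\,p)\wedge\mathbb C_{t_2}(\mathsf{snd}\,p)$ (the first applicable clause is used). *)

theory Defs
  imports Main
begin

section \<open>The language DM\<close>

text \<open>
  Both calculi use de Bruijn indices, index 0 being the innermost binder. A type-variable context
  is given by its length \<open>m\<close>; its variables are \<open>TVar 0, \<dots>, TVar (m - 1)\<close>.
  The parameter \<open>sg\<close> assigns to every constant its argument base types and its result base type.
\<close>

datatype eff = EffN | EffT

datatype 'b ty =
    TVar nat
  | TBase 'b
  | TArr eff "'b ty" "'b ty"
  | TSum "'b ty" "'b ty"
  | TProd "'b ty" "'b ty"

text \<open>The grammars of \<open>A\<close>, \<open>C\<close> and \<open>H\<close>, with type variables drawn from a context of length \<open>m\<close>.\<close>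

fun wf_A :: "nat \<Rightarrow> 'b ty \<Rightarrow> bool" where
  "wf_A m (TVar X) \<longleftrightarrow> X < m"
| "wf_A m (TBase b) \<longleftrightarrow> True"
| "wf_A m (TArr EffN A A') \<longleftrightarrow> wf_A m A \<and> wf_A m A'"
| "wf_A m (TArr EffT A A') \<longleftrightarrow> False"
| "wf_A m (TSum A A') \<longleftrightarrow> wf_A m A \<and> wf_A m A'"
| "wf_A m (TProd A A') \<longleftrightarrow> wf_A m A \<and> wf_A m A'"

fun wf_C :: "nat \<Rightarrow> 'b ty \<Rightarrow> bool" where
  "wf_C m (TArr EffT H A) \<longleftrightarrow> (wf_A m H \<or> wf_C m H) \<and> wf_A m A"
| "wf_C m (TArr EffN H C) \<longleftrightarrow> (wf_A m H \<or> wf_C m H) \<and> wf_C m C"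
| "wf_C m (TProd C C') \<longleftrightarrow> wf_C m C \<and> wf_C m C'"
| "wf_C m (TVar X) \<longleftrightarrow> False"
| "wf_C m (TBase b) \<longleftrightarrow> False"
| "wf_C m (TSum A A') \<longleftrightarrow> False"

definition wf_H :: "nat \<Rightarrow> 'b ty \<Rightarrow> bool" where
  "wf_H m H \<longleftrightarrow> wf_A m H \<or> wf_C m H"

datatype ('b, 'k) tm =
    DVar nat
  | DApp "('b, 'k) tm" "('b, 'k) tm"
  | DLam "'b ty" "('b, 'k) tm"
  | DConst 'k "('b, 'k) tm list"
  | DPair "('b, 'k) tm" "('b, 'k) tm"
  | DFst "('b, 'k) tm"
  | DSnd "('b, 'k) tm"
  | DInl "('b, 'k) tm"
  | DInr "('b, 'k) tm"
  | DCase "('b, 'k) tm" "'b ty" "('b, 'k) tm" "'b ty" "('b, 'k) tm"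
  | DReturn "('b, 'k) tm"
  | DBind "('b, 'k) tm" "('b, 'k) tm"

text \<open>
  \<open>DCase e A e1 A' e2\<close> binds one variable in each of \<open>e1\<close> and \<open>e2\<close>; \<open>DBind e1 e2\<close> binds one
  variable in \<open>e2\<close>.
\<close>

inductive typing ::
  "('k \<Rightarrow> 'b list \<times> 'b) \<Rightarrow> nat \<Rightarrow> 'b ty list \<Rightarrow> ('b, 'k) tm \<Rightarrow> 'b ty \<Rightarrow> eff \<Rightarrow> bool"
  for sg :: "'k \<Rightarrow> 'b list \<times> 'b" and m :: nat where
  ty_var: "\<lbrakk>i < length \<Gamma>; wf_H m (\<Gamma> ! i)\<rbrakk> \<Longrightarrow> typing sg m \<Gamma> (DVar i) (\<Gamma> ! i) EffN"
| ty_const: "\<lbrakk>sg \<kappa> = (bs, b); length es = length bs;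
    \<forall>i<length bs. typing sg m \<Gamma> (es ! i) (TBase (bs ! i)) EffN\<rbrakk>
    \<Longrightarrow> typing sg m \<Gamma> (DConst \<kappa> es) (TBase b) EffN"
| ty_lam: "\<lbrakk>wf_H m H; typing sg m (H # \<Gamma>) e H' \<epsilon>; wf_H m (TArr \<epsilon> H H')\<rbrakk>
    \<Longrightarrow> typing sg m \<Gamma> (DLam H e) (TArr \<epsilon> H H') EffN"
| ty_app: "\<lbrakk>typing sg m \<Gamma> f (TArr \<epsilon> H H') EffN; typing sg m \<Gamma> e H EffN\<rbrakk>
    \<Longrightarrow> typing sg m \<Gamma> (DApp f e) H' \<epsilon>"
| ty_pair: "\<lbrakk>typing sg m \<Gamma> e H EffN; typing sg m \<Gamma> e' H' EffN; wf_H m (TProd H H')\<rbrakk>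
    \<Longrightarrow> typing sg m \<Gamma> (DPair e e') (TProd H H') EffN"
| ty_fst: "typing sg m \<Gamma> e (TProd H H') EffN \<Longrightarrow> typing sg m \<Gamma> (DFst e) H EffN"
| ty_snd: "typing sg m \<Gamma> e (TProd H H') EffN \<Longrightarrow> typing sg m \<Gamma> (DSnd e) H' EffN"
| ty_inl: "\<lbrakk>typing sg m \<Gamma> e A EffN; wf_A m A; wf_A m A'\<rbrakk>
    \<Longrightarrow> typing sg m \<Gamma> (DInl e) (TSum A A') EffN"
| ty_inr: "\<lbrakk>typing sg m \<Gamma> e A' EffN; wf_A m A; wf_A m A'\<rbrakk>
    \<Longrightarrow> typing sg m \<Gamma> (DInr e) (TSum A A') EffN"
| ty_case: "\<lbrakk>typing sg m \<Gamma> e (TSum A A') EffN; wf_A m A; wf_A m A';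
    typing sg m (A # \<Gamma>) e1 H \<epsilon>; typing sg m (A' # \<Gamma>) e2 H \<epsilon>\<rbrakk>
    \<Longrightarrow> typing sg m \<Gamma> (DCase e A e1 A' e2) H \<epsilon>"
| ty_return: "\<lbrakk>typing sg m \<Gamma> e A EffN; wf_A m A\<rbrakk>
    \<Longrightarrow> typing sg m \<Gamma> (DReturn e) A EffT"
| ty_bind: "\<lbrakk>typing sg m \<Gamma> e1 A EffT; wf_A m A; typing sg m (A # \<Gamma>) e2 A' EffT; wf_A m A'\<rbrakk>
    \<Longrightarrow> typing sg m \<Gamma> (DBind e1 e2) A' EffT"


section \<open>The total fragment of EMF*\<close>

text \<open>
  Types, terms and formulas form one syntactic category. \<open>EPi\<close>, \<open>ELam\<close>, \<open>EAll\<close> and \<open>EEx\<close> bind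
  one variable in their second argument; \<open>ECase e t1 e1 t2 e2\<close> binds one in each of \<open>e1\<close> and
  \<open>e2\<close>. \<open>EEq t a b\<close> is propositional equality at type \<open>t\<close>.
\<close>

datatype ('b, 'k) exp =
    EVar nat
  | EType nat
  | EBase 'b
  | EConst 'k "('b, 'k) exp list"
  | EPi "('b, 'k) exp" "('b, 'k) exp"
  | ELam "('b, 'k) exp" "('b, 'k) exp"
  | EApp "('b, 'k) exp" "('b, 'k) exp"
  | EProd "('b, 'k) exp" "('b, 'k) exp"
  | EPair "('b, 'k) exp" "('b, 'k) exp"
  | EFst "('b, 'k) exp"
  | ESnd "('b, 'k) exp"
  | ESum "('b, 'k) exp" "('b, 'k) exp"
  | EInl "('b, 'k) exp"
  | EInr "('b, 'k) exp"
  | ECase "('b, 'k) exp" "('b, 'k) exp" "('b, 'k) exp" "('b, 'k) exp" "('b, 'k) exp"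
  | ETrue
  | EFalse
  | EAnd "('b, 'k) exp" "('b, 'k) exp"
  | EOr "('b, 'k) exp" "('b, 'k) exp"
  | EImp "('b, 'k) exp" "('b, 'k) exp"
  | EAll "('b, 'k) exp" "('b, 'k) exp"
  | EEx "('b, 'k) exp" "('b, 'k) exp"
  | EEq "('b, 'k) exp" "('b, 'k) exp" "('b, 'k) exp"

definition up_ren :: "(nat \<Rightarrow> nat) \<Rightarrow> nat \<Rightarrow> nat" where
  "up_ren \<rho> i = (case i of 0 \<Rightarrow> 0 | Suc j \<Rightarrow> Suc (\<rho> j))"

primrec ren :: "(nat \<Rightarrow> nat) \<Rightarrow> ('b, 'k) exp \<Rightarrow> ('b, 'k) exp" where
  "ren \<rho> (EVar i) = EVar (\<rho> i)"
| "ren \<rho> (EType i) = EType i"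
| "ren \<rho> (EBase b) = EBase b"
| "ren \<rho> (EConst \<kappa> es) = EConst \<kappa> (map (ren \<rho>) es)"
| "ren \<rho> (EPi t u) = EPi (ren \<rho> t) (ren (up_ren \<rho>) u)"
| "ren \<rho> (ELam t e) = ELam (ren \<rho> t) (ren (up_ren \<rho>) e)"
| "ren \<rho> (EApp e e') = EApp (ren \<rho> e) (ren \<rho> e')"
| "ren \<rho> (EProd t u) = EProd (ren \<rho> t) (ren \<rho> u)"
| "ren \<rho> (EPair e e') = EPair (ren \<rho> e) (ren \<rho> e')"
| "ren \<rho> (EFst e) = EFst (ren \<rho> e)"
| "ren \<rho> (ESnd e) = ESnd (ren \<rho> e)"
| "ren \<rho> (ESum t u) = ESum (ren \<rho> t) (ren \<rho> u)"
| "ren \<rho> (EInl e) = EInl (ren \<rho> e)"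
| "ren \<rho> (EInr e) = EInr (ren \<rho> e)"
| "ren \<rho> (ECase e t1 e1 t2 e2) =
    ECase (ren \<rho> e) (ren \<rho> t1) (ren (up_ren \<rho>) e1) (ren \<rho> t2) (ren (up_ren \<rho>) e2)"
| "ren \<rho> ETrue = ETrue"
| "ren \<rho> EFalse = EFalse"
| "ren \<rho> (EAnd p q) = EAnd (ren \<rho> p) (ren \<rho> q)"
| "ren \<rho> (EOr p q) = EOr (ren \<rho> p) (ren \<rho> q)"
| "ren \<rho> (EImp p q) = EImp (ren \<rho> p) (ren \<rho> q)"
| "ren \<rho> (EAll t p) = EAll (ren \<rho> t) (ren (up_ren \<rho>) p)"
| "ren \<rho> (EEx t p) = EEx (ren \<rho> t) (ren (up_ren \<rho>) p)"
| "ren \<rho> (EEq t a b) = EEq (ren \<rho> t) (ren \<rho> a) (ren \<rho> b)"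

abbreviation lift :: "('b, 'k) exp \<Rightarrow> ('b, 'k) exp" where
  "lift \<equiv> ren Suc"

definition up_sub :: "(nat \<Rightarrow> ('b, 'k) exp) \<Rightarrow> nat \<Rightarrow> ('b, 'k) exp" where
  "up_sub \<sigma> i = (case i of 0 \<Rightarrow> EVar 0 | Suc j \<Rightarrow> lift (\<sigma> j))"

primrec sub :: "(nat \<Rightarrow> ('b, 'k) exp) \<Rightarrow> ('b, 'k) exp \<Rightarrow> ('b, 'k) exp" where
  "sub \<sigma> (EVar i) = \<sigma> i"
| "sub \<sigma> (EType i) = EType i"
| "sub \<sigma> (EBase b) = EBase b"
| "sub \<sigma> (EConst \<kappa> es) = EConst \<kappa> (map (sub \<sigma>) es)"
| "sub \<sigma> (EPi t u) = EPi (sub \<sigma> t) (sub (up_sub \<sigma>) u)"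
| "sub \<sigma> (ELam t e) = ELam (sub \<sigma> t) (sub (up_sub \<sigma>) e)"
| "sub \<sigma> (EApp e e') = EApp (sub \<sigma> e) (sub \<sigma> e')"
| "sub \<sigma> (EProd t u) = EProd (sub \<sigma> t) (sub \<sigma> u)"
| "sub \<sigma> (EPair e e') = EPair (sub \<sigma> e) (sub \<sigma> e')"
| "sub \<sigma> (EFst e) = EFst (sub \<sigma> e)"
| "sub \<sigma> (ESnd e) = ESnd (sub \<sigma> e)"
| "sub \<sigma> (ESum t u) = ESum (sub \<sigma> t) (sub \<sigma> u)"
| "sub \<sigma> (EInl e) = EInl (sub \<sigma> e)"
| "sub \<sigma> (EInr e) = EInr (sub \<sigma> e)"
| "sub \<sigma> (ECase e t1 e1 t2 e2) =
    ECase (sub \<sigma> e) (sub \<sigma> t1) (sub (up_sub \<sigma>) e1) (sub \<sigma> t2) (sub (up_sub \<sigma>) e2)"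
| "sub \<sigma> ETrue = ETrue"
| "sub \<sigma> EFalse = EFalse"
| "sub \<sigma> (EAnd p q) = EAnd (sub \<sigma> p) (sub \<sigma> q)"
| "sub \<sigma> (EOr p q) = EOr (sub \<sigma> p) (sub \<sigma> q)"
| "sub \<sigma> (EImp p q) = EImp (sub \<sigma> p) (sub \<sigma> q)"
| "sub \<sigma> (EAll t p) = EAll (sub \<sigma> t) (sub (up_sub \<sigma>) p)"
| "sub \<sigma> (EEx t p) = EEx (sub \<sigma> t) (sub (up_sub \<sigma>) p)"
| "sub \<sigma> (EEq t a b) = EEq (sub \<sigma> t) (sub \<sigma> a) (sub \<sigma> b)"

text \<open>\<open>inst e a\<close> replaces index 0 of \<open>e\<close> by \<open>a\<close>.\<close>

definition inst :: "('b, 'k) exp \<Rightarrow> ('b, 'k) exp \<Rightarrow> ('b, 'k) exp" where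
  "inst e a = sub (\<lambda>i. case i of 0 \<Rightarrow> a | Suc j \<Rightarrow> EVar j) e"

text \<open>
  Convertibility is the congruent equivalence generated by \<open>\<beta>\<close>-reduction. It relates raw
  expressions, so the type-directed \<open>\<eta>\<close>-laws are instead rules of the validity judgment below.
\<close>

inductive conv :: "('b, 'k) exp \<Rightarrow> ('b, 'k) exp \<Rightarrow> bool" where
  cv_beta: "conv (EApp (ELam t e) a) (inst e a)"
| cv_fst_beta: "conv (EFst (EPair a b)) a"
| cv_snd_beta: "conv (ESnd (EPair a b)) b"
| cv_inl_beta: "conv (ECase (EInl a) t1 e1 t2 e2) (inst e1 a)"
| cv_inr_beta: "conv (ECase (EInr a) t1 e1 t2 e2) (inst e2 a)"
| cv_refl: "conv e e"
| cv_sym: "conv e e' \<Longrightarrow> conv e' e"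
| cv_trans: "conv e e' \<Longrightarrow> conv e' e'' \<Longrightarrow> conv e e''"
| cv_const: "list_all2 conv es es' \<Longrightarrow> conv (EConst \<kappa> es) (EConst \<kappa> es')"
| cv_pi: "conv t t' \<Longrightarrow> conv u u' \<Longrightarrow> conv (EPi t u) (EPi t' u')"
| cv_lam: "conv t t' \<Longrightarrow> conv e e' \<Longrightarrow> conv (ELam t e) (ELam t' e')"
| cv_app: "conv f f' \<Longrightarrow> conv e e' \<Longrightarrow> conv (EApp f e) (EApp f' e')"
| cv_prod: "conv t t' \<Longrightarrow> conv u u' \<Longrightarrow> conv (EProd t u) (EProd t' u')"
| cv_pair: "conv a a' \<Longrightarrow> conv b b' \<Longrightarrow> conv (EPair a b) (EPair a' b')"
| cv_fst: "conv e e' \<Longrightarrow> conv (EFst e) (EFst e')"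
| cv_snd: "conv e e' \<Longrightarrow> conv (ESnd e) (ESnd e')"
| cv_sum: "conv t t' \<Longrightarrow> conv u u' \<Longrightarrow> conv (ESum t u) (ESum t' u')"
| cv_inl: "conv e e' \<Longrightarrow> conv (EInl e) (EInl e')"
| cv_inr: "conv e e' \<Longrightarrow> conv (EInr e) (EInr e')"
| cv_case: "\<lbrakk>conv e e'; conv t1 t1'; conv e1 e1'; conv t2 t2'; conv e2 e2'\<rbrakk>
    \<Longrightarrow> conv (ECase e t1 e1 t2 e2) (ECase e' t1' e1' t2' e2')"
| cv_and: "conv p p' \<Longrightarrow> conv q q' \<Longrightarrow> conv (EAnd p q) (EAnd p' q')"
| cv_or: "conv p p' \<Longrightarrow> conv q q' \<Longrightarrow> conv (EOr p q) (EOr p' q')"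
| cv_imp: "conv p p' \<Longrightarrow> conv q q' \<Longrightarrow> conv (EImp p q) (EImp p' q')"
| cv_all: "conv t t' \<Longrightarrow> conv p p' \<Longrightarrow> conv (EAll t p) (EAll t' p')"
| cv_ex: "conv t t' \<Longrightarrow> conv p p' \<Longrightarrow> conv (EEx t p) (EEx t' p')"
| cv_eq: "conv t t' \<Longrightarrow> conv a a' \<Longrightarrow> conv b b' \<Longrightarrow> conv (EEq t a b) (EEq t' a' b')"

text \<open>
  \<open>typed sg \<Gamma> e t\<close> is the typing judgment. Contexts list types with the innermost variable first,
  each entry living in the context formed by the entries after it. Well-formedness of a context
  is presupposed and is checked by the rules that extend it. The logical connectives are squashed,
  hence quantification over a type of any universe stays in \<open>EType 0\<close>.
\<close>

inductive typed ::
  "('k \<Rightarrow> 'b list \<times> 'b) \<Rightarrow> ('b, 'k) exp list \<Rightarrow> ('b, 'k) exp \<Rightarrow> ('b, 'k) exp \<Rightarrow> bool"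
  for sg :: "'k \<Rightarrow> 'b list \<times> 'b" where
  t_var: "i < length \<Gamma> \<Longrightarrow> typed sg \<Gamma> (EVar i) (ren (\<lambda>j. j + Suc i) (\<Gamma> ! i))"
| t_type: "typed sg \<Gamma> (EType i) (EType (Suc i))"
| t_base: "typed sg \<Gamma> (EBase b) (EType 0)"
| t_const: "\<lbrakk>sg \<kappa> = (bs, b); length es = length bs;
    \<forall>i<length bs. typed sg \<Gamma> (es ! i) (EBase (bs ! i))\<rbrakk>
    \<Longrightarrow> typed sg \<Gamma> (EConst \<kappa> es) (EBase b)"
| t_pi: "\<lbrakk>typed sg \<Gamma> t (EType i); typed sg (t # \<Gamma>) u (EType j)\<rbrakk>
    \<Longrightarrow> typed sg \<Gamma> (EPi t u) (EType (max i j))"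
| t_lam: "\<lbrakk>typed sg \<Gamma> t (EType i); typed sg (t # \<Gamma>) e u\<rbrakk>
    \<Longrightarrow> typed sg \<Gamma> (ELam t e) (EPi t u)"
| t_app: "\<lbrakk>typed sg \<Gamma> f (EPi t u); typed sg \<Gamma> e t\<rbrakk>
    \<Longrightarrow> typed sg \<Gamma> (EApp f e) (inst u e)"
| t_prod: "\<lbrakk>typed sg \<Gamma> t (EType i); typed sg \<Gamma> u (EType j)\<rbrakk>
    \<Longrightarrow> typed sg \<Gamma> (EProd t u) (EType (max i j))"
| t_pair: "\<lbrakk>typed sg \<Gamma> a t; typed sg \<Gamma> b u\<rbrakk> \<Longrightarrow> typed sg \<Gamma> (EPair a b) (EProd t u)"
| t_fst: "typed sg \<Gamma> e (EProd t u) \<Longrightarrow> typed sg \<Gamma> (EFst e) t"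
| t_snd: "typed sg \<Gamma> e (EProd t u) \<Longrightarrow> typed sg \<Gamma> (ESnd e) u"
| t_sum: "\<lbrakk>typed sg \<Gamma> t (EType i); typed sg \<Gamma> u (EType j)\<rbrakk>
    \<Longrightarrow> typed sg \<Gamma> (ESum t u) (EType (max i j))"
| t_inl: "\<lbrakk>typed sg \<Gamma> a t; typed sg \<Gamma> u (EType j)\<rbrakk> \<Longrightarrow> typed sg \<Gamma> (EInl a) (ESum t u)"
| t_inr: "\<lbrakk>typed sg \<Gamma> b u; typed sg \<Gamma> t (EType i)\<rbrakk> \<Longrightarrow> typed sg \<Gamma> (EInr b) (ESum t u)"
| t_case: "\<lbrakk>typed sg \<Gamma> e (ESum t1 t2); typed sg \<Gamma> t (EType i);
    typed sg (t1 # \<Gamma>) e1 (lift t); typed sg (t2 # \<Gamma>) e2 (lift t)\<rbrakk>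
    \<Longrightarrow> typed sg \<Gamma> (ECase e t1 e1 t2 e2) t"
| t_true: "typed sg \<Gamma> ETrue (EType 0)"
| t_false: "typed sg \<Gamma> EFalse (EType 0)"
| t_and: "\<lbrakk>typed sg \<Gamma> p (EType 0); typed sg \<Gamma> q (EType 0)\<rbrakk>
    \<Longrightarrow> typed sg \<Gamma> (EAnd p q) (EType 0)"
| t_or: "\<lbrakk>typed sg \<Gamma> p (EType 0); typed sg \<Gamma> q (EType 0)\<rbrakk>
    \<Longrightarrow> typed sg \<Gamma> (EOr p q) (EType 0)"
| t_imp: "\<lbrakk>typed sg \<Gamma> p (EType 0); typed sg \<Gamma> q (EType 0)\<rbrakk>
    \<Longrightarrow> typed sg \<Gamma> (EImp p q) (EType 0)"
| t_all: "\<lbrakk>typed sg \<Gamma> t (EType i); typed sg (t # \<Gamma>) p (EType 0)\<rbrakk>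
    \<Longrightarrow> typed sg \<Gamma> (EAll t p) (EType 0)"
| t_ex: "\<lbrakk>typed sg \<Gamma> t (EType i); typed sg (t # \<Gamma>) p (EType 0)\<rbrakk>
    \<Longrightarrow> typed sg \<Gamma> (EEx t p) (EType 0)"
| t_eq: "\<lbrakk>typed sg \<Gamma> t (EType i); typed sg \<Gamma> a t; typed sg \<Gamma> b t\<rbrakk>
    \<Longrightarrow> typed sg \<Gamma> (EEq t a b) (EType 0)"
| t_conv: "\<lbrakk>typed sg \<Gamma> e t; conv t t'; typed sg \<Gamma> t' (EType i)\<rbrakk> \<Longrightarrow> typed sg \<Gamma> e t'"

text \<open>
  \<open>valid sg \<Gamma> \<Phi> \<phi>\<close> is validity of the formula \<open>\<phi>\<close> in the context consisting of the variables \<open>\<Gamma>\<close>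
  and the logical hypotheses \<open>\<Phi>\<close>. No proof terms occur in it.
\<close>

inductive valid ::
  "('k \<Rightarrow> 'b list \<times> 'b) \<Rightarrow> ('b, 'k) exp list \<Rightarrow> ('b, 'k) exp list \<Rightarrow> ('b, 'k) exp \<Rightarrow> bool"
  for sg :: "'k \<Rightarrow> 'b list \<times> 'b" where
  v_hyp: "p \<in> set \<Phi> \<Longrightarrow> valid sg \<Gamma> \<Phi> p"
| v_trueI: "valid sg \<Gamma> \<Phi> ETrue"
| v_falseE: "\<lbrakk>valid sg \<Gamma> \<Phi> EFalse; typed sg \<Gamma> p (EType 0)\<rbrakk> \<Longrightarrow> valid sg \<Gamma> \<Phi> p"
| v_andI: "\<lbrakk>valid sg \<Gamma> \<Phi> p; valid sg \<Gamma> \<Phi> q\<rbrakk> \<Longrightarrow> valid sg \<Gamma> \<Phi> (EAnd p q)"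
| v_andE1: "valid sg \<Gamma> \<Phi> (EAnd p q) \<Longrightarrow> valid sg \<Gamma> \<Phi> p"
| v_andE2: "valid sg \<Gamma> \<Phi> (EAnd p q) \<Longrightarrow> valid sg \<Gamma> \<Phi> q"
| v_orI1: "\<lbrakk>valid sg \<Gamma> \<Phi> p; typed sg \<Gamma> q (EType 0)\<rbrakk> \<Longrightarrow> valid sg \<Gamma> \<Phi> (EOr p q)"
| v_orI2: "\<lbrakk>valid sg \<Gamma> \<Phi> q; typed sg \<Gamma> p (EType 0)\<rbrakk> \<Longrightarrow> valid sg \<Gamma> \<Phi> (EOr p q)"
| v_orE: "\<lbrakk>valid sg \<Gamma> \<Phi> (EOr p q); valid sg \<Gamma> (p # \<Phi>) r; valid sg \<Gamma> (q # \<Phi>) r\<rbrakk>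
    \<Longrightarrow> valid sg \<Gamma> \<Phi> r"
| v_impI: "\<lbrakk>typed sg \<Gamma> p (EType 0); valid sg \<Gamma> (p # \<Phi>) q\<rbrakk> \<Longrightarrow> valid sg \<Gamma> \<Phi> (EImp p q)"
| v_impE: "\<lbrakk>valid sg \<Gamma> \<Phi> (EImp p q); valid sg \<Gamma> \<Phi> p\<rbrakk> \<Longrightarrow> valid sg \<Gamma> \<Phi> q"
| v_allI: "\<lbrakk>typed sg \<Gamma> t (EType i); valid sg (t # \<Gamma>) (map lift \<Phi>) p\<rbrakk>
    \<Longrightarrow> valid sg \<Gamma> \<Phi> (EAll t p)"
| v_allE: "\<lbrakk>valid sg \<Gamma> \<Phi> (EAll t p); typed sg \<Gamma> a t\<rbrakk> \<Longrightarrow> valid sg \<Gamma> \<Phi> (inst p a)"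
| v_exI: "\<lbrakk>typed sg (t # \<Gamma>) p (EType 0); typed sg \<Gamma> a t; valid sg \<Gamma> \<Phi> (inst p a)\<rbrakk>
    \<Longrightarrow> valid sg \<Gamma> \<Phi> (EEx t p)"
| v_exE: "\<lbrakk>valid sg \<Gamma> \<Phi> (EEx t p); valid sg (t # \<Gamma>) (p # map lift \<Phi>) (lift r)\<rbrakk>
    \<Longrightarrow> valid sg \<Gamma> \<Phi> r"
| v_em: "typed sg \<Gamma> p (EType 0) \<Longrightarrow> valid sg \<Gamma> \<Phi> (EOr p (EImp p EFalse))"
| v_conv: "\<lbrakk>typed sg \<Gamma> a t; typed sg \<Gamma> b t; conv a b\<rbrakk> \<Longrightarrow> valid sg \<Gamma> \<Phi> (EEq t a b)"
| v_eta: "typed sg \<Gamma> f (EPi t u)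
    \<Longrightarrow> valid sg \<Gamma> \<Phi> (EEq (EPi t u) (ELam t (EApp (lift f) (EVar 0))) f)"
| v_pair_eta: "typed sg \<Gamma> e (EProd t u)
    \<Longrightarrow> valid sg \<Gamma> \<Phi> (EEq (EProd t u) (EPair (EFst e) (ESnd e)) e)"
| v_subst: "\<lbrakk>valid sg \<Gamma> \<Phi> (EEq t a b); typed sg (t # \<Gamma>) p (EType 0); valid sg \<Gamma> \<Phi> (inst p a)\<rbrakk>
    \<Longrightarrow> valid sg \<Gamma> \<Phi> (inst p b)"
| v_funext: "\<lbrakk>typed sg \<Gamma> f (EPi t u); typed sg \<Gamma> g (EPi t u);
    valid sg \<Gamma> \<Phi> (EAll t (EEq u (EApp (lift f) (EVar 0)) (EApp (lift g) (EVar 0))))\<rbrakk>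
    \<Longrightarrow> valid sg \<Gamma> \<Phi> (EEq (EPi t u) f g)"
| v_sum: "typed sg \<Gamma> e (ESum t1 t2) \<Longrightarrow> valid sg \<Gamma> \<Phi>
    (EOr (EEx t1 (EEq (lift (ESum t1 t2)) (lift e) (EInl (EVar 0))))
         (EEx t2 (EEq (lift (ESum t1 t2)) (lift e) (EInr (EVar 0)))))"

text \<open>Reflexivity of equality is the instance of \<open>v_conv\<close> with \<open>cv_refl\<close>.\<close>


section \<open>The star translation\<close>

text \<open>Non-dependent total types over the type variables, possibly mentioning the universe 0.\<close>

datatype 'b sty =
    SVar nat
  | SBase 'b
  | SType0
  | SArr "'b sty" "'b sty"
  | SSum "'b sty" "'b sty"
  | SProd "'b sty" "'b sty"

text \<open>
  \<open>emb k t\<close> is the type \<open>t\<close> as an expression in a context where \<open>k\<close> variables have been declared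
  after the type variables.
\<close>

fun emb :: "nat \<Rightarrow> 'b sty \<Rightarrow> ('b, 'k) exp" where
  "emb k (SVar X) = EVar (k + X)"
| "emb k (SBase b) = EBase b"
| "emb k SType0 = EType 0"
| "emb k (SArr t u) = EPi (emb k t) (emb (Suc k) u)"
| "emb k (SSum t u) = ESum (emb k t) (emb k u)"
| "emb k (SProd t u) = EProd (emb k t) (emb k u)"

fun star_ty :: "'b ty \<Rightarrow> 'b sty" where
  "star_ty (TVar X) = SVar X"
| "star_ty (TBase b) = SBase b"
| "star_ty (TArr EffN H H') = SArr (star_ty H) (star_ty H')"
| "star_ty (TArr EffT H A) =
    SArr (star_ty H) (SArr (SArr (star_ty A) SType0) SType0)"
| "star_ty (TSum A A') = SSum (star_ty A) (star_ty A')"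
| "star_ty (TProd H H') = SProd (star_ty H) (star_ty H')"

text \<open>
  The translation of terms depends on the typing derivation (the term syntax does not record the
  type of the first computation of a bind, nor the other summand of an injection), so it is a
  relation: \<open>star sg m \<Gamma> e H \<epsilon> e'\<close> says that \<open>e'\<close> is the translation of \<open>e\<close> along some derivation
  of \<open>typing sg m \<Gamma> e H \<epsilon>\<close>. In the bind rule, \<open>e2'\<close> is moved below the new variable \<open>p\<close>, which
  is inserted just outside its own innermost variable.
\<close>

inductive star ::
  "('k \<Rightarrow> 'b list \<times> 'b) \<Rightarrow> nat \<Rightarrow> 'b ty list \<Rightarrow> ('b, 'k) tm \<Rightarrow> 'b ty \<Rightarrow> eff \<Rightarrow> ('b, 'k) exp \<Rightarrow> bool"
  for sg :: "'k \<Rightarrow> 'b list \<times> 'b" and m :: nat where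
  st_var: "\<lbrakk>i < length \<Gamma>; wf_H m (\<Gamma> ! i)\<rbrakk> \<Longrightarrow> star sg m \<Gamma> (DVar i) (\<Gamma> ! i) EffN (EVar i)"
| st_const: "\<lbrakk>sg \<kappa> = (bs, b); length es = length bs; length es' = length bs;
    \<forall>i<length bs. star sg m \<Gamma> (es ! i) (TBase (bs ! i)) EffN (es' ! i)\<rbrakk>
    \<Longrightarrow> star sg m \<Gamma> (DConst \<kappa> es) (TBase b) EffN (EConst \<kappa> es')"
| st_lam: "\<lbrakk>wf_H m H; star sg m (H # \<Gamma>) e H' \<epsilon> e'; wf_H m (TArr \<epsilon> H H')\<rbrakk>
    \<Longrightarrow> star sg m \<Gamma> (DLam H e) (TArr \<epsilon> H H') EffN (ELam (emb (length \<Gamma>) (star_ty H)) e')"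
| st_app: "\<lbrakk>star sg m \<Gamma> f (TArr \<epsilon> H H') EffN f'; star sg m \<Gamma> e H EffN e'\<rbrakk>
    \<Longrightarrow> star sg m \<Gamma> (DApp f e) H' \<epsilon> (EApp f' e')"
| st_pair: "\<lbrakk>star sg m \<Gamma> e1 H EffN e1'; star sg m \<Gamma> e2 H' EffN e2'; wf_H m (TProd H H')\<rbrakk>
    \<Longrightarrow> star sg m \<Gamma> (DPair e1 e2) (TProd H H') EffN (EPair e1' e2')"
| st_fst: "star sg m \<Gamma> e (TProd H H') EffN e' \<Longrightarrow> star sg m \<Gamma> (DFst e) H EffN (EFst e')"
| st_snd: "star sg m \<Gamma> e (TProd H H') EffN e' \<Longrightarrow> star sg m \<Gamma> (DSnd e) H' EffN (ESnd e')"
| st_inl: "\<lbrakk>star sg m \<Gamma> e A EffN e'; wf_A m A; wf_A m A'\<rbrakk>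
    \<Longrightarrow> star sg m \<Gamma> (DInl e) (TSum A A') EffN (EInl e')"
| st_inr: "\<lbrakk>star sg m \<Gamma> e A' EffN e'; wf_A m A; wf_A m A'\<rbrakk>
    \<Longrightarrow> star sg m \<Gamma> (DInr e) (TSum A A') EffN (EInr e')"
| st_case: "\<lbrakk>star sg m \<Gamma> e (TSum A A') EffN e'; wf_A m A; wf_A m A';
    star sg m (A # \<Gamma>) e1 H \<epsilon> e1'; star sg m (A' # \<Gamma>) e2 H \<epsilon> e2'\<rbrakk>
    \<Longrightarrow> star sg m \<Gamma> (DCase e A e1 A' e2) H \<epsilon>
      (ECase e' (emb (length \<Gamma>) (star_ty A)) e1' (emb (length \<Gamma>) (star_ty A')) e2')"
| st_return: "\<lbrakk>star sg m \<Gamma> e A EffN e'; wf_A m A\<rbrakk>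
    \<Longrightarrow> star sg m \<Gamma> (DReturn e) A EffT
      (ELam (emb (length \<Gamma>) (SArr (star_ty A) SType0)) (EApp (EVar 0) (lift e')))"
| st_bind: "\<lbrakk>star sg m \<Gamma> e1 A EffT e1'; wf_A m A; star sg m (A # \<Gamma>) e2 A' EffT e2'; wf_A m A'\<rbrakk>
    \<Longrightarrow> star sg m \<Gamma> (DBind e1 e2) A' EffT
      (ELam (emb (length \<Gamma>) (SArr (star_ty A') SType0))
        (EApp (lift e1')
          (ELam (emb (Suc (length \<Gamma>)) (star_ty A)) (EApp (ren (up_ren Suc) e2') (EVar 1)))))"

lemma typing_iff_star: "typing sg m \<Gamma> e H \<epsilon> \<longleftrightarrow> (\<exists>e'. star sg m \<Gamma> e H \<epsilon> e')"
proof
  assume "typing sg m \<Gamma> e H \<epsilon>"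
  then show "\<exists>e'. star sg m \<Gamma> e H \<epsilon> e'"
  proof induction
    case (ty_const \<kappa> bs b es \<Gamma>)
    then obtain g where "\<forall>i<length bs. star sg m \<Gamma> (es ! i) (TBase (bs ! i)) EffN (g i)"
      by metis
    then have "star sg m \<Gamma> (DConst \<kappa> es) (TBase b) EffN (EConst \<kappa> (map g [0..<length bs]))"
      using ty_const by (intro st_const) auto
    then show ?case ..
  qed (blast intro: star.intros)+
next
  assume "\<exists>e'. star sg m \<Gamma> e H \<epsilon> e'"
  then obtain e' where "star sg m \<Gamma> e H \<epsilon> e'" ..
  then show "typing sg m \<Gamma> e H \<epsilon>"
    by induction (auto intro: typing.intros)
qed


section \<open>Conjunctivity\<close>

fun predicate_free :: "'b sty \<Rightarrow> bool" where
  "predicate_free (SVar X) \<longleftrightarrow> True"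
| "predicate_free (SBase b) \<longleftrightarrow> True"
| "predicate_free SType0 \<longleftrightarrow> False"
| "predicate_free (SArr t u) \<longleftrightarrow> predicate_free t \<and> predicate_free u"
| "predicate_free (SSum t u) \<longleftrightarrow> predicate_free t \<and> predicate_free u"
| "predicate_free (SProd t u) \<longleftrightarrow> predicate_free t \<and> predicate_free u"

definition wp_conjunctive :: "nat \<Rightarrow> 'b sty \<Rightarrow> ('b, 'k) exp \<Rightarrow> ('b, 'k) exp" where
  "wp_conjunctive k a w =
    EAll (emb k (SArr a SType0)) (EAll (emb (Suc k) (SArr a SType0))
      (EEq (EType 0)
        (EAnd (EApp (lift (lift w)) (EVar 1)) (EApp (lift (lift w)) (EVar 0)))
        (EApp (lift (lift w))
          (ELam (emb (Suc (Suc k)) a)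
            (EAnd (EApp (EVar 2) (EVar 0)) (EApp (EVar 1) (EVar 0)))))))"

text \<open>
  \<open>conjunctive k t x\<close> is the conjunctivity formula of the type \<open>t\<close> for \<open>x\<close>, where \<open>k\<close> is as in
  \<open>emb\<close>. The value \<open>EFalse\<close> only fills in types outside the class on which the formula is
  defined; by \<open>star_ty_in_conj_class\<close> below no such type arises from the translation.
\<close>

fun conjunctive :: "nat \<Rightarrow> 'b sty \<Rightarrow> ('b, 'k) exp \<Rightarrow> ('b, 'k) exp" where
  "conjunctive k (SArr t u) x =
    (if \<exists>a. t = SArr a SType0 \<and> u = SType0 \<and> predicate_free a
     then wp_conjunctive k (case t of SArr a _ \<Rightarrow> a) x
     else if predicate_free (SArr t u) then ETrue
     else EAll (emb k t)
       (EImp (conjunctive (Suc k) t (EVar 0)) (conjunctive (Suc k) u (EApp (lift x) (EVar 0)))))"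
| "conjunctive k (SProd t u) x =
    (if predicate_free (SProd t u) then ETrue
     else EAnd (conjunctive k t (EFst x)) (conjunctive k u (ESnd x)))"
| "conjunctive k t x = (if predicate_free t then ETrue else EFalse)"

inductive conj_class :: "'b sty \<Rightarrow> bool" where
  "predicate_free a \<Longrightarrow> conj_class (SArr (SArr a SType0) SType0)"
| "predicate_free a \<Longrightarrow> conj_class a"
| "conj_class t \<Longrightarrow> conj_class u \<Longrightarrow> conj_class (SArr t u)"
| "conj_class t \<Longrightarrow> conj_class u \<Longrightarrow> conj_class (SProd t u)"

lemma predicate_free_star_ty: "wf_A m A \<Longrightarrow> predicate_free (star_ty A)"
  by (induction m A rule: wf_A.induct) auto

lemma star_ty_in_conj_class: "wf_H m H \<Longrightarrow> conj_class (star_ty H)"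
proof -
  have "wf_C m C \<Longrightarrow> conj_class (star_ty C)" for C :: "'a ty"
    by (induction m C rule: wf_C.induct)
      (auto intro: conj_class.intros dest: predicate_free_star_ty)
  then show "wf_H m H \<Longrightarrow> conj_class (star_ty H)"
    by (auto simp: wf_H_def intro: conj_class.intros dest: predicate_free_star_ty)
qed

text \<open>The target context declaring \<open>m\<close> type variables of type \<open>EType 0\<close>.\<close>

definition tyvar_ctx :: "nat \<Rightarrow> ('b, 'k) exp list" where
  "tyvar_ctx m = replicate m (EType 0)"

end

(*
  Conjunctivity is proved for open terms by induction on the translation, assuming the conjunctivity
  formula of every variable in scope; a computation of type A counts as a value of type
  (A -> Type_0) -> Type_0, which is what makes the cases of application and case analysis uniform in
  the effect. Since A* is predicate-free, nothing is to be shown at type A. For return,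
  both sides of the conjunctivity equation beta-reduce to p1 e /\ p2 e. For bind, conjunctivity of
  e1 merges the two continuations (lambda x. e2 p1) and (lambda x. e2 p2) into their pointwise
  conjunction, and conjunctivity of e2 under the binder, with function extensionality, turns that
  into (lambda x. e2 (p1 /\ p2)).
*)
theory Submission
  imports Defs
begin

section \<open>Renaming and substitution\<close>

text \<open>Conversion is untyped, whereas \<open>v_conv\<close> yields an equality only between
  terms already typed at a common type. Hence each beta step that enters the logic comes with typing
  derivations for both of its sides, and type preservation of the translation is settled before
  conjunctivity. An equality is exploited by substitution into a typed formula with a hole.
  Symmetry, transitivity, congruence of application, the passage between convertible formulas and
  the replacement of a scrutinee all come from a suitable choice of that hole; equality under a
  binder comes from function extensionality. The order of the clauses of conjunctivity matters too.
  An arrow into \<open>SType0\<close> may trigger the weakest-precondition clause; the arrow types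
  produced by \<open>star_ty\<close> for DM arrows never do so at their root, because their codomain
  is never \<open>SType0\<close> itself.\<close>

lemma up_ren_simps [simp]: "up_ren \<rho> 0 = 0" "up_ren \<rho> (Suc i) = Suc (\<rho> i)"
  by (simp_all add: up_ren_def)

lemma up_sub_simps [simp]: "up_sub \<sigma> 0 = EVar 0" "up_sub \<sigma> (Suc i) = lift (\<sigma> i)"
  by (simp_all add: up_sub_def)

lemma up_ren_comp: "(\<lambda>i. up_ren \<rho> (up_ren \<rho>' i)) = up_ren (\<lambda>i. \<rho> (\<rho>' i))"
  by (rule ext) (simp add: up_ren_def split: nat.split)

lemma ren_ren: "ren \<rho> (ren \<rho>' e) = ren (\<lambda>i. \<rho> (\<rho>' i)) e"
  by (induction e arbitrary: \<rho> \<rho>') (simp_all add: up_ren_comp)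

lemma ren_up_lift [simp]: "ren (up_ren \<rho>) (lift e) = lift (ren \<rho> e)"
  by (simp add: ren_ren)

lemma up_sub_up_ren: "(\<lambda>i. up_sub \<sigma> (up_ren \<rho> i)) = up_sub (\<lambda>i. \<sigma> (\<rho> i))"
  by (rule ext) (simp add: up_ren_def up_sub_def split: nat.split)

lemma sub_ren: "sub \<sigma> (ren \<rho> e) = sub (\<lambda>i. \<sigma> (\<rho> i)) e"
  by (induction e arbitrary: \<sigma> \<rho>) (simp_all add: up_sub_up_ren)

lemma ren_up_sub: "(\<lambda>i. ren (up_ren \<rho>) (up_sub \<sigma> i)) = up_sub (\<lambda>i. ren \<rho> (\<sigma> i))"
  by (rule ext) (simp add: up_sub_def split: nat.split)

lemma ren_sub: "ren \<rho> (sub \<sigma> e) = sub (\<lambda>i. ren \<rho> (\<sigma> i)) e"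
  by (induction e arbitrary: \<sigma> \<rho>) (simp_all add: ren_up_sub)

lemma sub_up_lift [simp]: "sub (up_sub \<sigma>) (lift e) = lift (sub \<sigma> e)"
  by (simp add: sub_ren ren_sub)

lemma up_sub_EVar: "up_sub (\<lambda>i. EVar (\<rho> i)) = (\<lambda>i. EVar (up_ren \<rho> i))"
  by (rule ext) (simp add: up_sub_def up_ren_def split: nat.split)

lemma sub_EVar: "sub (\<lambda>i. EVar (\<rho> i)) e = ren \<rho> e"
  by (induction e arbitrary: \<rho>) (simp_all add: up_sub_EVar)

lemma sub_EVar_id [simp]: "sub EVar e = ren (\<lambda>i. i) e"
  using sub_EVar[of "\<lambda>i. i" e] by simp

lemma up_ren_id: "up_ren (\<lambda>i. i) = (\<lambda>i. i)"
  by (rule ext) (simp add: up_ren_def split: nat.split)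

lemma ren_id [simp]: "ren (\<lambda>i. i) e = e"
  by (induction e) (simp_all add: up_ren_id map_idI)

abbreviation inst_sub :: "('b, 'k) exp \<Rightarrow> nat \<Rightarrow> ('b, 'k) exp" where
  "inst_sub a \<equiv> \<lambda>i. case i of 0 \<Rightarrow> a | Suc j \<Rightarrow> EVar j"

lemma inst_lift [simp]: "sub (inst_sub a) (lift e) = e"
  by (simp add: sub_ren sub_EVar[where \<rho> = "\<lambda>i. i"])

text \<open>The renaming opens a slot just outside the innermost variable and the substitution fills
  it, while nothing in \<open>e\<close> refers to it. Beta-reducing a translated bind leaves this
  behind.\<close>

lemma sub_up_inst_up_Suc [simp]: "sub (up_sub (inst_sub a)) (ren (up_ren Suc) e) = e"
proof -
  have "(\<lambda>i. up_sub (inst_sub a) (up_ren Suc i)) = EVar"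
    by (rule ext) (simp add: up_sub_def up_ren_def split: nat.split)
  then show ?thesis
    by (simp only: sub_ren sub_EVar_id ren_id)
qed

text \<open>Carrying a body under a new binder and then feeding it the new variable gives the body
  back; this is the beta step whenever a lifted abstraction, quantifier or branch is opened at a
  fresh variable.\<close>

lemma inst_up_Suc_EVar0 [simp]:
  fixes e :: "('b, 'k) exp"
  shows "sub (inst_sub (EVar 0)) (ren (up_ren Suc) e) = e"
proof -
  have "(\<lambda>i. inst_sub (EVar 0) (up_ren Suc i)) = (EVar :: nat \<Rightarrow> ('b, 'k) exp)"
    by (rule ext) (simp add: up_ren_def split: nat.split)
  then show ?thesis
    by (simp only: sub_ren sub_EVar_id ren_id)
qed

lemma ren_inst: "ren \<rho> (inst e a) = inst (ren (up_ren \<rho>) e) (ren \<rho> a)"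
proof -
  have "(\<lambda>i. ren \<rho> (inst_sub a i)) = (\<lambda>i. inst_sub (ren \<rho> a) (up_ren \<rho> i))"
    by (rule ext) (simp split: nat.split)
  then show ?thesis
    by (simp add: inst_def ren_sub sub_ren)
qed

lemma conv_ren: "conv e e' \<Longrightarrow> conv (ren \<rho> e) (ren \<rho> e')"
proof (induction arbitrary: \<rho> rule: conv.induct)
  case (cv_const es es' \<kappa>)
  then have "list_all2 conv (map (ren \<rho>) es) (map (ren \<rho>) es')"
    by (auto simp: list_all2_conv_all_nth)
  then show ?case
    by (simp add: conv.cv_const)
next
  case (cv_sym e e')
  then show ?case by (blast intro: conv.cv_sym)
next
  case (cv_trans e e' e'')
  then show ?case by (blast intro: conv.cv_trans)
qed (auto simp: ren_inst intro: conv.intros)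

section \<open>Renaming of typing derivations\<close>

text \<open>A context entry lives in the tail behind it, so the types of a variable and of its image
  can be compared only after both are shifted into their full contexts, as in
  \<open>t_var\<close>.\<close>

definition ren_typing :: "(nat \<Rightarrow> nat) \<Rightarrow> ('b, 'k) exp list \<Rightarrow> ('b, 'k) exp list \<Rightarrow> bool" where
  "ren_typing \<rho> \<Gamma> \<Gamma>' \<longleftrightarrow> (\<forall>i<length \<Gamma>. \<rho> i < length \<Gamma>' \<and>
     ren (\<lambda>j. j + Suc (\<rho> i)) (\<Gamma>' ! \<rho> i) = ren \<rho> (ren (\<lambda>j. j + Suc i) (\<Gamma> ! i)))"

lemma ren_typing_Suc: "ren_typing Suc \<Gamma> (t # \<Gamma>)"
  by (simp add: ren_typing_def ren_ren)

lemma ren_typing_up: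
  assumes "ren_typing \<rho> \<Gamma> \<Gamma>'"
  shows "ren_typing (up_ren \<rho>) (t # \<Gamma>) (ren \<rho> t # \<Gamma>')"
  unfolding ren_typing_def
proof (intro allI impI)
  fix i assume i: "i < length (t # \<Gamma>)"
  show "up_ren \<rho> i < length (ren \<rho> t # \<Gamma>') \<and>
     ren (\<lambda>j. j + Suc (up_ren \<rho> i)) ((ren \<rho> t # \<Gamma>') ! up_ren \<rho> i) =
     ren (up_ren \<rho>) (ren (\<lambda>j. j + Suc i) ((t # \<Gamma>) ! i))"
  proof (cases i)
    case 0
    then show ?thesis by (simp add: ren_ren)
  next
    case (Suc n)
    then have "\<rho> n < length \<Gamma>'"
      and "ren (\<lambda>j. j + Suc (\<rho> n)) (\<Gamma>' ! \<rho> n) = ren \<rho> (ren (\<lambda>j. j + Suc n) (\<Gamma> ! n))"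
      using i assms by (auto simp: ren_typing_def)
    from this(1) arg_cong[OF this(2), of lift] Suc show ?thesis
      by (simp add: ren_ren)
  qed
qed

lemma typed_ren:
  "typed sg \<Gamma> e t \<Longrightarrow> ren_typing \<rho> \<Gamma> \<Gamma>' \<Longrightarrow> typed sg \<Gamma>' (ren \<rho> e) (ren \<rho> t)"
proof (induction arbitrary: \<rho> \<Gamma>' rule: typed.induct)
  case (t_var i \<Gamma>)
  then show ?case
    using typed.t_var[of "\<rho> i" \<Gamma>' sg] by (simp add: ren_typing_def)
next
  case (t_app \<Gamma> f t u e)
  then show ?case
    by (simp add: ren_inst) (blast intro: typed.t_app)
next
  case (t_case \<Gamma> e t1 t2 t i e1 e2)
  have "typed sg (ren \<rho> t1 # \<Gamma>') (ren (up_ren \<rho>) e1) (lift (ren \<rho> t))"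
    and "typed sg (ren \<rho> t2 # \<Gamma>') (ren (up_ren \<rho>) e2) (lift (ren \<rho> t))"
    using t_case.IH(3,4)[OF ren_typing_up[OF t_case.prems]] by simp_all
  moreover have "typed sg \<Gamma>' (ren \<rho> e) (ESum (ren \<rho> t1) (ren \<rho> t2))"
    and "typed sg \<Gamma>' (ren \<rho> t) (EType i)"
    using t_case.IH(1,2)[OF t_case.prems] by simp_all
  ultimately show ?case
    by (simp add: typed.t_case)
next
  case (t_conv \<Gamma> e t t' i)
  then show ?case
    by (metis conv_ren ren.simps(2) typed.t_conv)
qed (auto intro: typed.intros(2-6,8-14,16-23) ren_typing_up,
    (blast intro: typed.intros(5,6,13,14,21-23) ren_typing_up)+)

lemma typed_lift: "typed sg \<Gamma> e t \<Longrightarrow> typed sg (s # \<Gamma>) (lift e) (lift t)"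
  by (rule typed_ren[OF _ ren_typing_Suc])

lemma typed_up_Suc:
  "typed sg (s # \<Gamma>) e t \<Longrightarrow> typed sg (lift s # r # \<Gamma>) (ren (up_ren Suc) e) (ren (up_ren Suc) t)"
  by (rule typed_ren[OF _ ren_typing_up[OF ren_typing_Suc]])

section \<open>Non-dependent types\<close>

fun tyvars_below :: "nat \<Rightarrow> 'b sty \<Rightarrow> bool" where
  "tyvars_below m (SVar X) \<longleftrightarrow> X < m"
| "tyvars_below m (SBase b) \<longleftrightarrow> True"
| "tyvars_below m SType0 \<longleftrightarrow> True"
| "tyvars_below m (SArr t u) \<longleftrightarrow> tyvars_below m t \<and> tyvars_below m u"
| "tyvars_below m (SSum t u) \<longleftrightarrow> tyvars_below m t \<and> tyvars_below m u"
| "tyvars_below m (SProd t u) \<longleftrightarrow> tyvars_below m t \<and> tyvars_below m u"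

definition declares_tyvars :: "nat \<Rightarrow> nat \<Rightarrow> ('b, 'k) exp list \<Rightarrow> bool" where
  "declares_tyvars m k \<Gamma> \<longleftrightarrow> (\<forall>X<m. k + X < length \<Gamma> \<and> \<Gamma> ! (k + X) = EType 0)"

lemma declares_tyvars_Cons [simp]: "declares_tyvars m k \<Gamma> \<Longrightarrow> declares_tyvars m (Suc k) (t # \<Gamma>)"
  by (simp add: declares_tyvars_def)

text \<open>An embedded type mentions only indices from \<open>k\<close> on, so only the values of
  the renaming there count. \<open>k\<close> varies in the induction because \<open>EPi\<close>
  binds a variable even when the arrow is non-dependent.\<close>

lemma ren_emb: "(\<And>X. \<rho> (k + X) = k' + X) \<Longrightarrow> ren \<rho> (emb k t) = emb k' t"
  by (induction t arbitrary: k k' \<rho>) simp_all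

lemma lift_emb [simp]: "lift (emb k t) = emb (Suc k) t"
  by (rule ren_emb) simp

lemma ren_up_Suc_emb [simp]: "ren (up_ren Suc) (emb (Suc k) t) = emb (Suc (Suc k)) t"
  by (rule ren_emb) simp

lemma sub_emb: "(\<And>X. \<sigma> (k + X) = EVar (k' + X)) \<Longrightarrow> sub \<sigma> (emb k t) = emb k' t"
  by (induction t arbitrary: k k' \<sigma>) simp_all

lemma inst_emb [simp]:
  "sub (inst_sub a) (emb (Suc k) t) = emb k t"
  "sub (up_sub (inst_sub a)) (emb (Suc (Suc k)) t) = emb (Suc k) t"
  "sub (up_sub (up_sub (inst_sub a))) (emb (Suc (Suc (Suc k))) t) = emb (Suc (Suc k)) t"
  by (simp_all add: sub_emb)

lemma typed_emb:
  "declares_tyvars m k \<Gamma> \<Longrightarrow> tyvars_below m t \<Longrightarrow> \<exists>i. typed sg \<Gamma> (emb k t) (EType i)"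
proof (induction t arbitrary: k \<Gamma>)
  case (SVar X)
  then have "k + X < length \<Gamma>" and "\<Gamma> ! (k + X) = EType 0"
    by (auto simp: declares_tyvars_def)
  then show ?case
    using t_var[of "k + X" \<Gamma> sg] by auto
next
  case (SArr t u)
  obtain i where "typed sg \<Gamma> (emb k t) (EType i)"
    using SArr.IH(1)[OF SArr.prems(1)] SArr.prems(2) by (metis tyvars_below.simps(4))
  moreover obtain j where "typed sg (emb k t # \<Gamma>) (emb (Suc k) u) (EType j)"
    using SArr.IH(2)[OF declares_tyvars_Cons[OF SArr.prems(1)]] SArr.prems(2)
    by (metis tyvars_below.simps(4))
  ultimately show ?case
    by (auto intro: t_pi)
next
  case (SSum t u)
  then obtain i j where "typed sg \<Gamma> (emb k t) (EType i)" "typed sg \<Gamma> (emb k u) (EType j)"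
    by (metis tyvars_below.simps(5))
  then show ?case by (auto intro: t_sum)
next
  case (SProd t u)
  then obtain i j where "typed sg \<Gamma> (emb k t) (EType i)" "typed sg \<Gamma> (emb k u) (EType j)"
    by (metis tyvars_below.simps(6))
  then show ?case by (auto intro: t_prod)
qed (auto intro: t_base t_type)

lemma typed_var0: "typed sg (emb k t # \<Gamma>) (EVar 0) (emb (Suc k) t)"
  using t_var[of 0 "emb k t # \<Gamma>" sg] by simp

lemma typed_var1: "typed sg (s # emb k t # \<Gamma>) (EVar (Suc 0)) (emb (Suc (Suc k)) t)"
  using typed_lift[OF typed_var0] by simp

lemma typed_lift_emb: "typed sg \<Gamma> e (emb k t) \<Longrightarrow> typed sg (s # \<Gamma>) (lift e) (emb (Suc k) t)"
  using typed_lift by fastforce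

lemma typed_up_Suc_emb:
  "typed sg (emb k s # \<Gamma>) e (emb (Suc k) t) \<Longrightarrow>
   typed sg (emb (Suc k) s # r # \<Gamma>) (ren (up_ren Suc) e) (emb (Suc (Suc k)) t)"
  using typed_up_Suc[of sg "emb k s" \<Gamma> e "emb (Suc k) t" r] by simp

lemma typed_app_emb:
  "typed sg \<Gamma> f (emb k (SArr t u)) \<Longrightarrow> typed sg \<Gamma> e (emb k t) \<Longrightarrow> typed sg \<Gamma> (EApp f e) (emb k u)"
  using t_app[of sg \<Gamma> f "emb k t" "emb (Suc k) u" e] by (simp add: inst_def)

lemma typed_app_pred:
  "typed sg \<Gamma> f (emb k (SArr t SType0)) \<Longrightarrow> typed sg \<Gamma> e (emb k t) \<Longrightarrow>
   typed sg \<Gamma> (EApp f e) (EType 0)"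
  using typed_app_emb[of sg \<Gamma> f k t SType0] by simp

lemma typed_lam_emb:
  "declares_tyvars m k \<Gamma> \<Longrightarrow> tyvars_below m t \<Longrightarrow> typed sg (emb k t # \<Gamma>) e (emb (Suc k) u) \<Longrightarrow>
   typed sg \<Gamma> (ELam (emb k t) e) (emb k (SArr t u))"
  using typed_emb[of m k \<Gamma> t sg] by (auto intro: t_lam)

lemma typed_lam_pred:
  "declares_tyvars m k \<Gamma> \<Longrightarrow> tyvars_below m t \<Longrightarrow> typed sg (emb k t # \<Gamma>) e (EType 0) \<Longrightarrow>
   typed sg \<Gamma> (ELam (emb k t) e) (emb k (SArr t SType0))"
  using typed_lam_emb[of m k \<Gamma> t sg e SType0] by simp

lemma typed_all_emb:
  "declares_tyvars m k \<Gamma> \<Longrightarrow> tyvars_below m t \<Longrightarrow> typed sg (emb k t # \<Gamma>) p (EType 0) \<Longrightarrow>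
   typed sg \<Gamma> (EAll (emb k t) p) (EType 0)"
  using typed_emb[of m k \<Gamma> t sg] by (auto intro: t_all)

section \<open>Pointwise conjunction of predicates and the weakest-precondition formula\<close>

abbreviation wp_ty :: "'b sty \<Rightarrow> 'b sty" where
  "wp_ty a \<equiv> SArr (SArr a SType0) SType0"

definition pred_and :: "nat \<Rightarrow> 'b sty \<Rightarrow> ('b, 'k) exp \<Rightarrow> ('b, 'k) exp \<Rightarrow> ('b, 'k) exp" where
  "pred_and k a p q =
    ELam (emb k a) (EAnd (EApp (lift p) (EVar 0)) (EApp (lift q) (EVar 0)))"

lemma wp_conjunctive_eq:
  "wp_conjunctive k a w =
    EAll (emb k (SArr a SType0)) (EAll (emb (Suc k) (SArr a SType0))
      (EEq (EType 0)
        (EAnd (EApp (lift (lift w)) (EVar 1)) (EApp (lift (lift w)) (EVar 0)))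
        (EApp (lift (lift w)) (pred_and (Suc (Suc k)) a (EVar 1) (EVar 0)))))"
  by (simp add: wp_conjunctive_def pred_and_def numeral_2_eq_2)

lemma lift_pred_and [simp]: "lift (pred_and k a p q) = pred_and (Suc k) a (lift p) (lift q)"
  by (simp add: pred_and_def)

lemma typed_pred_and:
  assumes "declares_tyvars m k \<Gamma>" "tyvars_below m a"
    and "typed sg \<Gamma> p (emb k (SArr a SType0))" "typed sg \<Gamma> q (emb k (SArr a SType0))"
  shows "typed sg \<Gamma> (pred_and k a p q) (emb k (SArr a SType0))"
  unfolding pred_and_def
  by (intro typed_lam_pred[OF assms(1,2)] t_and typed_app_pred[where t = a and k = "Suc k"]
      typed_lift_emb assms typed_var0)

lemma typed_wp_conjunctive:
  assumes \<Gamma>: "declares_tyvars m k \<Gamma>" and a: "tyvars_below m a"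
    and w: "typed sg \<Gamma> w (emb k (wp_ty a))"
  shows "typed sg \<Gamma> (wp_conjunctive k a w) (EType 0)"
proof -
  let ?P = "\<lambda>k. emb k (SArr a SType0)"
  let ?\<Gamma> = "?P (Suc k) # ?P k # \<Gamma>"
  have w': "typed sg ?\<Gamma> (lift (lift w)) (emb (Suc (Suc k)) (wp_ty a))"
    by (intro typed_lift_emb w)
  have \<Gamma>': "declares_tyvars m (Suc k) (?P k # \<Gamma>)" "declares_tyvars m (Suc (Suc k)) ?\<Gamma>"
    using \<Gamma> by simp_all
  have a': "tyvars_below m (SArr a SType0)" using a by simp
  have v: "typed sg ?\<Gamma> (EVar 1) (?P (Suc (Suc k)))" "typed sg ?\<Gamma> (EVar 0) (?P (Suc (Suc k)))"
    by (simp_all only: One_nat_def typed_var1 typed_var0)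
  show ?thesis
    unfolding wp_conjunctive_eq
    by (intro typed_all_emb[OF \<Gamma> a'] typed_all_emb[OF \<Gamma>'(1) a'] t_eq[OF t_type] t_and
        typed_app_pred[OF w'] v typed_pred_and[OF \<Gamma>'(2) a])
qed

section \<open>Conjunctivity formulas\<close>

lemma ren_wp_conjunctive:
  "(\<And>X. \<rho> (k + X) = k' + X) \<Longrightarrow> ren \<rho> (wp_conjunctive k a w) = wp_conjunctive k' a (ren \<rho> w)"
  by (simp add: wp_conjunctive_def ren_emb numeral_2_eq_2)

lemma lift_wp_conjunctive [simp]:
  "lift (wp_conjunctive k a w) = wp_conjunctive (Suc k) a (lift w)"
  "ren (up_ren Suc) (wp_conjunctive (Suc k) a w) =
    wp_conjunctive (Suc (Suc k)) a (ren (up_ren Suc) w)"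
  by (simp_all add: ren_wp_conjunctive)

lemma sub_wp_conjunctive:
  "(\<And>X. \<sigma> (k + X) = EVar (k' + X)) \<Longrightarrow>
   sub \<sigma> (wp_conjunctive k a w) = wp_conjunctive k' a (sub \<sigma> w)"
  by (simp add: wp_conjunctive_def sub_emb numeral_2_eq_2)

lemma inst_wp_conjunctive:
  "inst (wp_conjunctive (Suc k) a w) x = wp_conjunctive k a (inst w x)"
  unfolding inst_def by (rule sub_wp_conjunctive) simp

text \<open>Which clause of \<open>conjunctive\<close> applies depends on the type alone, so a
  renaming cannot change it.\<close>

lemma ren_conjunctive:
  "(\<And>X. \<rho> (k + X) = k' + X) \<Longrightarrow> ren \<rho> (conjunctive k t x) = conjunctive k' t (ren \<rho> x)"
proof (induction k t x arbitrary: k' \<rho> rule: conjunctive.induct)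
  case (1 k t u x)
  show ?case
  proof (cases "\<exists>a. t = SArr a SType0 \<and> u = SType0 \<and> predicate_free a")
    case True
    then show ?thesis
      using 1(3) by (auto simp: ren_wp_conjunctive)
  next
    case False
    then show ?thesis
      using 1 by (auto simp: ren_emb)
  qed
qed simp_all

lemma lift_conjunctive [simp]: "lift (conjunctive k t x) = conjunctive (Suc k) t (lift x)"
  by (rule ren_conjunctive) simp

lemma sub_conjunctive:
  "(\<And>X. \<sigma> (k + X) = EVar (k' + X)) \<Longrightarrow> sub \<sigma> (conjunctive k t x) = conjunctive k' t (sub \<sigma> x)"
proof (induction k t x arbitrary: k' \<sigma> rule: conjunctive.induct)
  case (1 k t u x)
  show ?case
  proof (cases "\<exists>a. t = SArr a SType0 \<and> u = SType0 \<and> predicate_free a")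
    case True
    then show ?thesis
      using 1(3) by (auto simp: sub_wp_conjunctive)
  next
    case False
    then show ?thesis
      using 1 by (auto simp: sub_emb)
  qed
qed simp_all

lemma inst_conjunctive [simp]:
  "inst (conjunctive (Suc k) t x) a = conjunctive k t (inst x a)"
  unfolding inst_def by (rule sub_conjunctive) simp

lemma conv_wp_conjunctive: "conv w w' \<Longrightarrow> conv (wp_conjunctive k a w) (wp_conjunctive k a w')"
  unfolding wp_conjunctive_def by (intro cv_all cv_eq cv_and cv_app cv_refl conv_ren)

lemma conv_conjunctive: "conv x y \<Longrightarrow> conv (conjunctive k t x) (conjunctive k t y)"
proof (induction t arbitrary: k x y)
  case (SArr t u)
  have "conv (EApp (lift x) (EVar 0)) (EApp (lift y) (EVar 0))"
    by (intro cv_app cv_refl conv_ren SArr.prems)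
  then show ?case
    using SArr by (auto intro!: cv_refl cv_all cv_imp conv_wp_conjunctive)
next
  case (SProd t u)
  then have "conv (conjunctive k t (EFst x)) (conjunctive k t (EFst y))"
    and "conv (conjunctive k u (ESnd x)) (conjunctive k u (ESnd y))"
    by (blast intro: cv_fst cv_snd)+
  then show ?case
    by (auto intro: cv_refl cv_and)
qed (auto intro: cv_refl)

text \<open>Required wherever the formula is assumed, converted or substituted into. Types outside
  the conjunctivity class cause no trouble, since their default \<open>EFalse\<close> is a formula
  as well.\<close>

lemma typed_conjunctive:
  "declares_tyvars m k \<Gamma> \<Longrightarrow> tyvars_below m t \<Longrightarrow> typed sg \<Gamma> x (emb k t) \<Longrightarrow>
   typed sg \<Gamma> (conjunctive k t x) (EType 0)"
proof (induction t arbitrary: k \<Gamma> x)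
  case (SArr t u)
  show ?case
  proof (cases "\<exists>a. t = SArr a SType0 \<and> u = SType0 \<and> predicate_free a")
    case True
    then show ?thesis
      using SArr.prems by (auto intro!: typed_wp_conjunctive)
  next
    case False
    have "typed sg (emb k t # \<Gamma>) (EApp (lift x) (EVar 0)) (emb (Suc k) u)"
      by (rule typed_app_emb[OF typed_lift_emb[OF SArr.prems(3)] typed_var0])
    then have "typed sg \<Gamma> (EAll (emb k t) (EImp (conjunctive (Suc k) t (EVar 0))
        (conjunctive (Suc k) u (EApp (lift x) (EVar 0))))) (EType 0)"
      using SArr.prems(1,2)
      by (intro typed_all_emb[where m = m] t_imp SArr.IH typed_var0) auto
    with False show ?thesis
      by (auto intro: t_true)
  qed
next
  case (SProd t u)
  then show ?case
    by (auto intro!: t_true t_and SProd.IH dest: t_fst t_snd)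
qed (auto intro: t_true t_false)

text \<open>A predicate-free arrow cannot end in \<open>SType0\<close>, so the weakest-precondition
  clause, although tried first, never captures it.\<close>

lemma conjunctive_predicate_free: "predicate_free t \<Longrightarrow> conjunctive k t x = ETrue"
  by (cases t) auto

section \<open>Derived rules of validity\<close>

lemma valid_mono: "valid sg \<Gamma> \<Phi> p \<Longrightarrow> set \<Phi> \<subseteq> set \<Psi> \<Longrightarrow> valid sg \<Gamma> \<Psi> p"
proof (induction arbitrary: \<Psi> rule: valid.induct)
  case (v_hyp p \<Phi> \<Gamma>)
  then show ?case by (auto intro: valid.v_hyp)
next
  case (v_orE \<Gamma> \<Phi> p q r)
  have "set (p # \<Phi>) \<subseteq> set (p # \<Psi>)" "set (q # \<Phi>) \<subseteq> set (q # \<Psi>)"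
    using v_orE.prems by auto
  then show ?case
    using v_orE by (blast intro: valid.v_orE)
next
  case (v_impI \<Gamma> p \<Phi> q)
  have "set (p # \<Phi>) \<subseteq> set (p # \<Psi>)"
    using v_impI.prems by auto
  then show ?case
    using v_impI by (blast intro: valid.v_impI)
next
  case (v_allI \<Gamma> t i \<Phi> p)
  have "set (map lift \<Phi>) \<subseteq> set (map lift \<Psi>)"
    using v_allI.prems by auto
  then show ?case
    using v_allI by (blast intro: valid.v_allI)
next
  case (v_exE \<Gamma> \<Phi> t p r)
  have "set (p # map lift \<Phi>) \<subseteq> set (p # map lift \<Psi>)"
    using v_exE.prems by auto
  then show ?case
    using v_exE by (blast intro: valid.v_exE)
qed (blast intro: valid.intros)+

text \<open>
  Weakening of validity by a variable is never needed: cutting in the formula as a hypothesis first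
  lets \<open>v_allI\<close> lift it.
\<close>

lemma valid_cut:
  "typed sg \<Gamma> p (EType 0) \<Longrightarrow> valid sg \<Gamma> \<Phi> p \<Longrightarrow> valid sg \<Gamma> (p # \<Phi>) q \<Longrightarrow> valid sg \<Gamma> \<Phi> q"
  by (blast intro: v_impE v_impI)

text \<open>\<open>v_subst\<close> ends in \<open>inst p b\<close>, which rarely matches a goal
  syntactically. Here both instances are free and tied to \<open>p\<close> by equations left to the
  simplifier.\<close>

lemma valid_subst:
  assumes "valid sg \<Gamma> \<Phi> (EEq t a b)" "typed sg (t # \<Gamma>) p (EType 0)"
    and "valid sg \<Gamma> \<Phi> p1" "inst p a = p1" "inst p b = p2"
  shows "valid sg \<Gamma> \<Phi> p2"
  using v_subst[of sg \<Gamma> \<Phi> t a b p] assms by simp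

lemma typed_var_head: "typed sg (t # \<Gamma>) (EVar 0) (lift t)"
  using t_var[of 0 "t # \<Gamma>" sg] by simp

text \<open>Two formulas with a hole: substituting into the first gives transitivity, into the
  second symmetry.\<close>

lemma typed_eq_lift:
  "typed sg \<Gamma> t (EType i) \<Longrightarrow> typed sg \<Gamma> a t \<Longrightarrow>
   typed sg (t # \<Gamma>) (EEq (lift t) (lift a) (EVar 0)) (EType 0)"
  "typed sg \<Gamma> t (EType i) \<Longrightarrow> typed sg \<Gamma> a t \<Longrightarrow>
   typed sg (t # \<Gamma>) (EEq (lift t) (EVar 0) (lift a)) (EType 0)"
  using typed_lift[of sg \<Gamma> t "EType i" t] typed_lift[of sg \<Gamma> a t t] typed_var_head[of sg t \<Gamma>]
  by (auto intro: t_eq)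

lemma valid_eq_sym:
  assumes "typed sg \<Gamma> t (EType i)" "typed sg \<Gamma> a t" "valid sg \<Gamma> \<Phi> (EEq t a b)"
  shows "valid sg \<Gamma> \<Phi> (EEq t b a)"
  by (rule valid_subst[OF assms(3) typed_eq_lift(2)[OF assms(1,2)] v_conv[OF assms(2,2) cv_refl]])
    (simp_all add: inst_def)

lemma valid_eq_trans:
  assumes "typed sg \<Gamma> t (EType i)" "typed sg \<Gamma> a t"
    and "valid sg \<Gamma> \<Phi> (EEq t a b)" "valid sg \<Gamma> \<Phi> (EEq t b c)"
  shows "valid sg \<Gamma> \<Phi> (EEq t a c)"
  by (rule valid_subst[OF assms(4) typed_eq_lift(1)[OF assms(1,2)] assms(3)])
    (simp_all add: inst_def)

lemma valid_eq_app:
  assumes u: "typed sg \<Gamma> (emb k u) (EType i)"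
    and F: "typed sg \<Gamma> F (emb k (SArr t u))" and a: "typed sg \<Gamma> a (emb k t)"
    and eq: "valid sg \<Gamma> \<Phi> (EEq (emb k t) a b)"
  shows "valid sg \<Gamma> \<Phi> (EEq (emb k u) (EApp F a) (EApp F b))"
proof -
  \<comment> \<open>The hole is the argument on the right; at \<open>a\<close> the formula is an
    instance of reflexivity.\<close>
  let ?p = "EEq (emb (Suc k) u) (lift (EApp F a)) (EApp (lift F) (EVar 0))"
  have p: "typed sg (emb k t # \<Gamma>) ?p (EType 0)"
    using typed_lift[OF u]
    by (intro t_eq[of _ _ _ i] typed_lift_emb typed_app_emb[OF F a]
        typed_app_emb[OF typed_lift_emb[OF F]] typed_var0) simp
  have Fa: "typed sg \<Gamma> (EApp F a) (emb k u)"
    by (rule typed_app_emb[OF F a])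
  show ?thesis
    by (rule valid_subst[OF eq p v_conv[OF Fa Fa cv_refl]]) (simp_all add: inst_def)
qed

text \<open>Convertible propositions are equal at \<open>EType 0\<close>, and substitution into the
  formula that is a bare variable turns such an equality into a passage from one proposition to the
  other.\<close>

lemma valid_conv:
  assumes "valid sg \<Gamma> \<Phi> p" "conv p q" "typed sg \<Gamma> p (EType 0)" "typed sg \<Gamma> q (EType 0)"
  shows "valid sg \<Gamma> \<Phi> q"
proof (rule valid_subst[OF v_conv[OF assms(3,4,2)] _ assms(1), of "EVar 0"])
  show "typed sg (EType 0 # \<Gamma>) (EVar 0) (EType 0)"
    using typed_var_head[of sg "EType 0" \<Gamma>] by simp
qed (simp_all add: inst_def)

lemma conv_lam_lift_app: "conv (EApp (lift (ELam t e)) (EVar 0)) e"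
  using cv_beta[of "lift t" "ren (up_ren Suc) e" "EVar 0"] by (simp add: inst_def)

text \<open>\<open>v_funext\<close> compares the two abstractions applied to a fresh variable, and
  these applications beta-reduce to the bodies.\<close>

lemma valid_eq_lam:
  assumes \<Gamma>: "declares_tyvars m k \<Gamma>" and t: "tyvars_below m t" and u: "tyvars_below m u"
    and e: "typed sg (emb k t # \<Gamma>) e (emb (Suc k) u)" "typed sg (emb k t # \<Gamma>) e' (emb (Suc k) u)"
    and eq: "valid sg (emb k t # \<Gamma>) (map lift \<Phi>) (EEq (emb (Suc k) u) e e')"
  shows "valid sg \<Gamma> \<Phi> (EEq (emb k (SArr t u)) (ELam (emb k t) e) (ELam (emb k t) e'))"
proof -
  let ?\<Gamma> = "emb k t # \<Gamma>"
  have \<Gamma>': "declares_tyvars m (Suc k) ?\<Gamma>" using \<Gamma> by simp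
  obtain i j where ty: "typed sg \<Gamma> (emb k t) (EType i)" "typed sg ?\<Gamma> (emb (Suc k) u) (EType j)"
    using typed_emb[OF \<Gamma> t] typed_emb[OF \<Gamma>' u] by blast
  have lam: "typed sg \<Gamma> (ELam (emb k t) e) (emb k (SArr t u))"
    "typed sg \<Gamma> (ELam (emb k t) e') (emb k (SArr t u))"
    using typed_lam_emb[OF \<Gamma> t] e by blast+
  then have app: "typed sg ?\<Gamma> (EApp (lift (ELam (emb k t) e)) (EVar 0)) (emb (Suc k) u)"
    "typed sg ?\<Gamma> (EApp (lift (ELam (emb k t) e')) (EVar 0)) (emb (Suc k) u)"
    by (blast intro: typed_app_emb typed_lift_emb typed_var0)+
  have "valid sg ?\<Gamma> (map lift \<Phi>) (EEq (emb (Suc k) u)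
      (EApp (lift (ELam (emb k t) e)) (EVar 0)) (EApp (lift (ELam (emb k t) e')) (EVar 0)))"
    by (rule valid_conv[OF eq])
      (intro cv_eq cv_refl cv_sym[OF conv_lam_lift_app] t_eq[OF ty(2)] e app)+
  then show ?thesis
    using v_funext v_allI[OF ty(1)] lam by fastforce
qed

lemma wp_conjunctiveD:
  assumes w: "valid sg \<Gamma> \<Phi> (wp_conjunctive k a w)"
    and p: "typed sg \<Gamma> p (emb k (SArr a SType0))" and q: "typed sg \<Gamma> q (emb k (SArr a SType0))"
  shows "valid sg \<Gamma> \<Phi>
    (EEq (EType 0) (EAnd (EApp w p) (EApp w q)) (EApp w (pred_and k a p q)))"
  using v_allE[OF v_allE[OF w[unfolded wp_conjunctive_def] p, unfolded inst_def, simplified],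
      OF q[simplified]]
  by (simp add: inst_def pred_and_def numeral_2_eq_2)

section \<open>Translated computations\<close>

definition star_return :: "nat \<Rightarrow> 'b sty \<Rightarrow> ('b, 'k) exp \<Rightarrow> ('b, 'k) exp" where
  "star_return k a e = ELam (emb k (SArr a SType0)) (EApp (EVar 0) (lift e))"

definition star_bind ::
  "nat \<Rightarrow> 'b sty \<Rightarrow> 'b sty \<Rightarrow> ('b, 'k) exp \<Rightarrow> ('b, 'k) exp \<Rightarrow> ('b, 'k) exp" where
  "star_bind k a b e f = ELam (emb k (SArr b SType0))
     (EApp (lift e) (ELam (emb (Suc k) a) (EApp (ren (up_ren Suc) f) (EVar 1))))"

lemma lift_star_return [simp]: "lift (star_return k a e) = star_return (Suc k) a (lift e)"
  by (simp add: star_return_def)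

text \<open>Both sides fix index 0 and raise every other index by two. The left side is what lifting
  \<open>star_bind\<close> produces.\<close>

lemma ren_up_up:
  "ren (up_ren (up_ren Suc)) (ren (up_ren Suc) e) = ren (up_ren Suc) (ren (up_ren Suc) e)"
proof -
  have "(\<lambda>i. up_ren (up_ren Suc) (up_ren Suc i)) = (\<lambda>i. up_ren Suc (up_ren Suc i))"
    by (rule ext) (simp add: up_ren_def split: nat.split)
  then show ?thesis
    by (simp only: ren_ren)
qed

lemma lift_star_bind [simp]:
  "lift (star_bind k a b e f) = star_bind (Suc k) a b (lift e) (ren (up_ren Suc) f)"
  by (simp add: star_bind_def ren_up_up)

lemma conv_star_return: "conv (EApp (star_return k a e) p) (EApp p e)"
  using cv_beta[of "emb k (SArr a SType0)" "EApp (EVar 0) (lift e)" p]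
  by (simp add: star_return_def inst_def)

text \<open>The continuation handed to the first computation of a bind once the predicate
  \<open>p\<close> of the whole bind is supplied.\<close>

definition bind_cont :: "nat \<Rightarrow> 'b sty \<Rightarrow> ('b, 'k) exp \<Rightarrow> ('b, 'k) exp \<Rightarrow> ('b, 'k) exp" where
  "bind_cont k a f p = ELam (emb k a) (EApp f (lift p))"

lemma conv_star_bind: "conv (EApp (star_bind k a b e f) p) (EApp e (bind_cont k a f p))"
  using cv_beta[of "emb k (SArr b SType0)"
      "EApp (lift e) (ELam (emb (Suc k) a) (EApp (ren (up_ren Suc) f) (EVar 1)))" p]
  by (simp add: star_bind_def bind_cont_def inst_def)

lemma typed_star_return:
  assumes \<Gamma>: "declares_tyvars m k \<Gamma>" and a: "tyvars_below m a" and e: "typed sg \<Gamma> e (emb k a)"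
  shows "typed sg \<Gamma> (star_return k a e) (emb k (wp_ty a))"
  unfolding star_return_def
  by (rule typed_lam_pred[OF \<Gamma> _ typed_app_pred[OF typed_var0 typed_lift_emb[OF e]]])
    (simp add: a)

lemma typed_bind_cont:
  assumes \<Gamma>: "declares_tyvars m k \<Gamma>" and a: "tyvars_below m a"
    and f: "typed sg (emb k a # \<Gamma>) f (emb (Suc k) (wp_ty b))"
    and p: "typed sg \<Gamma> p (emb k (SArr b SType0))"
  shows "typed sg \<Gamma> (bind_cont k a f p) (emb k (SArr a SType0))"
  unfolding bind_cont_def
  by (rule typed_lam_pred[OF \<Gamma> a typed_app_pred[OF f typed_lift_emb[OF p]]])

lemma typed_star_bind:
  assumes \<Gamma>: "declares_tyvars m k \<Gamma>" and ab: "tyvars_below m a" "tyvars_below m b"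
    and e: "typed sg \<Gamma> e (emb k (wp_ty a))"
    and f: "typed sg (emb k a # \<Gamma>) f (emb (Suc k) (wp_ty b))"
  shows "typed sg \<Gamma> (star_bind k a b e f) (emb k (wp_ty b))"
proof -
  let ?\<Gamma> = "emb k (SArr b SType0) # \<Gamma>"
  have \<Gamma>': "declares_tyvars m (Suc k) ?\<Gamma>" using \<Gamma> by simp
  have b: "tyvars_below m (SArr b SType0)" using ab by simp
  have "typed sg ?\<Gamma> (bind_cont (Suc k) a (ren (up_ren Suc) f) (EVar 0)) (emb (Suc k) (SArr a SType0))"
    by (rule typed_bind_cont[OF \<Gamma>' ab(1) typed_up_Suc_emb[OF f] typed_var0])
  then have "typed sg ?\<Gamma> (EApp (lift e) (bind_cont (Suc k) a (ren (up_ren Suc) f) (EVar 0))) (EType 0)"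
    by (rule typed_app_pred[OF typed_lift_emb[OF e]])
  then show ?thesis
    using typed_lam_pred[OF \<Gamma> b] by (simp add: star_bind_def bind_cont_def)
qed

section \<open>Conjunctivity of return and bind\<close>

lemma wp_conjunctiveI:
  fixes k :: nat and a :: "'b sty" and \<Gamma> :: "('b, 'k) exp list"
  defines "\<Gamma>' \<equiv> emb (Suc k) (SArr a SType0) # emb k (SArr a SType0) # \<Gamma>"
  assumes \<Gamma>: "declares_tyvars m k \<Gamma>" and a: "tyvars_below m a"
    and eq: "valid sg \<Gamma>' (map lift (map lift \<Phi>))
      (EEq (EType 0) (EAnd (EApp (lift (lift w)) (EVar 1)) (EApp (lift (lift w)) (EVar 0)))
        (EApp (lift (lift w)) (pred_and (Suc (Suc k)) a (EVar 1) (EVar 0))))"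
  shows "valid sg \<Gamma> \<Phi> (wp_conjunctive k a w)"
proof -
  have a': "tyvars_below m (SArr a SType0)" using a by simp
  obtain i j where "typed sg \<Gamma> (emb k (SArr a SType0)) (EType i)"
    "typed sg (emb k (SArr a SType0) # \<Gamma>) (emb (Suc k) (SArr a SType0)) (EType j)"
    using typed_emb[OF \<Gamma> a'] typed_emb[OF declares_tyvars_Cons[OF \<Gamma>] a'] by blast
  then show ?thesis
    unfolding wp_conjunctive_eq using eq unfolding \<Gamma>'_def by (intro v_allI)
qed

lemma wp_conjunctive_star_return:
  assumes \<Gamma>: "declares_tyvars m k \<Gamma>" and a: "tyvars_below m a" and e: "typed sg \<Gamma> e (emb k a)"
  shows "valid sg \<Gamma> \<Phi> (wp_conjunctive k a (star_return k a e))"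
proof (rule wp_conjunctiveI[OF \<Gamma> a])
  let ?\<Gamma> = "emb (Suc k) (SArr a SType0) # emb k (SArr a SType0) # \<Gamma>"
  let ?k = "Suc (Suc k)"
  let ?w = "lift (lift (star_return k a e))"
  have \<Gamma>': "declares_tyvars m ?k ?\<Gamma>" using \<Gamma> by simp
  have v: "typed sg ?\<Gamma> (EVar 1) (emb ?k (SArr a SType0))"
    "typed sg ?\<Gamma> (EVar 0) (emb ?k (SArr a SType0))"
    by (simp_all only: One_nat_def typed_var1 typed_var0)
  have w: "typed sg ?\<Gamma> ?w (emb ?k (wp_ty a))"
    by (intro typed_lift_emb typed_star_return[OF assms])
  have "conv (EApp (pred_and ?k a (EVar 1) (EVar 0)) (lift (lift e)))
      (EAnd (EApp (EVar 1) (lift (lift e))) (EApp (EVar 0) (lift (lift e))))"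
    \<comment> \<open>Below the abstraction of \<open>pred_and\<close> the two predicates are the
      variables 2 and 1, and variable 0 is its own argument.\<close>
    using cv_beta[of "emb ?k a" "EAnd (EApp (EVar 2) (EVar 0)) (EApp (EVar 1) (EVar 0))"
        "lift (lift e)"]
    by (simp add: pred_and_def inst_def numeral_2_eq_2)
  then have "conv (EAnd (EApp ?w (EVar 1)) (EApp ?w (EVar 0)))
      (EApp ?w (pred_and ?k a (EVar 1) (EVar 0)))"
    using conv_star_return[of ?k a "lift (lift e)"]
    by (simp del: One_nat_def) (meson cv_and cv_sym cv_trans)
  then show "valid sg ?\<Gamma> (map lift (map lift \<Phi>)) (EEq (EType 0)
      (EAnd (EApp ?w (EVar 1)) (EApp ?w (EVar 0))) (EApp ?w (pred_and ?k a (EVar 1) (EVar 0))))"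
    by (intro v_conv t_and typed_app_pred[OF w] v typed_pred_and[OF \<Gamma>' a])
qed

text \<open>Arbitrary predicates \<open>p\<close> and \<open>q\<close> keep the two quantifiers of
  the conjunctivity formula out of the argument; the bind case uses it at the variables 1 and 0 of
  the extended context.\<close>

lemma bind_cont_pred_and:
  assumes \<Gamma>: "declares_tyvars m k \<Gamma>" and a: "tyvars_below m a" and b: "tyvars_below m b"
    and e: "typed sg \<Gamma> e (emb k (wp_ty a))"
    and f: "typed sg (emb k a # \<Gamma>) f (emb (Suc k) (wp_ty b))"
    and p: "typed sg \<Gamma> p (emb k (SArr b SType0))" and q: "typed sg \<Gamma> q (emb k (SArr b SType0))"
    and ve: "valid sg \<Gamma> \<Phi> (wp_conjunctive k a e)"
    and vf: "valid sg (emb k a # \<Gamma>) (map lift \<Phi>) (wp_conjunctive (Suc k) b f)"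
  shows "valid sg \<Gamma> \<Phi> (EEq (EType 0)
    (EAnd (EApp e (bind_cont k a f p)) (EApp e (bind_cont k a f q)))
    (EApp e (bind_cont k a f (pred_and k b p q))))"
proof -
  let ?P = "bind_cont k a f p" and ?Q = "bind_cont k a f q"
  let ?B = "EAnd (EApp f (lift p)) (EApp f (lift q))"
  note p' = typed_lift_emb[OF p, of "emb k a"] and q' = typed_lift_emb[OF q, of "emb k a"]
  note \<Gamma>' = declares_tyvars_Cons[OF \<Gamma>, of "emb k a"]
  note P = typed_bind_cont[OF \<Gamma> a f p] and Q = typed_bind_cont[OF \<Gamma> a f q]
  have PQ: "typed sg \<Gamma> (pred_and k a ?P ?Q) (emb k (SArr a SType0))"
    by (rule typed_pred_and[OF \<Gamma> a P Q])
  have pq: "typed sg (emb k a # \<Gamma>) (lift (pred_and k b p q)) (emb (Suc k) (SArr b SType0))"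
    by (rule typed_lift_emb[OF typed_pred_and[OF \<Gamma> b p q]])
  have B: "typed sg (emb k a # \<Gamma>) ?B (EType 0)"
    by (intro t_and typed_app_pred[OF f] p' q')
  have C: "typed sg (emb k a # \<Gamma>) (EApp f (lift (pred_and k b p q))) (EType 0)"
    by (rule typed_app_pred[OF f pq])
  have lamB: "typed sg \<Gamma> (ELam (emb k a) ?B) (emb k (SArr a SType0))"
    by (rule typed_lam_pred[OF \<Gamma> a B])
  have T: "typed sg \<Gamma> (EType 0) (EType (Suc 0))" by (rule t_type)
  have eq1: "valid sg \<Gamma> \<Phi> (EEq (EType 0) (EAnd (EApp e ?P) (EApp e ?Q))
      (EApp e (pred_and k a ?P ?Q)))"
    by (rule wp_conjunctiveD[OF ve P Q])
  have "conv (EApp (lift ?P) (EVar 0)) (EApp f (lift p))"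
    "conv (EApp (lift ?Q) (EVar 0)) (EApp f (lift q))"
    unfolding bind_cont_def by (rule conv_lam_lift_app)+
  \<comment> \<open>Applying each continuation to the variable of \<open>pred_and\<close> reduces
    its body to \<open>?B\<close>, so conjunctivity of \<open>e\<close> already speaks of the
    abstraction over \<open>?B\<close>.\<close>
  then have "conv (pred_and k a ?P ?Q) (ELam (emb k a) ?B)"
    unfolding pred_and_def by (intro cv_lam cv_and cv_refl)
  then have eq2: "valid sg \<Gamma> \<Phi> (EEq (EType 0) (EApp e (pred_and k a ?P ?Q))
      (EApp e (ELam (emb k a) ?B)))"
    by (intro v_conv cv_app cv_refl typed_app_pred[OF e] PQ lamB)
  \<comment> \<open>The bodies agree by conjunctivity of \<open>f\<close> at the lifted predicates,
    because \<open>pred_and\<close> commutes with \<open>lift\<close>.\<close>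
  have "valid sg \<Gamma> \<Phi> (EEq (emb k (SArr a SType0)) (ELam (emb k a) ?B)
      (bind_cont k a f (pred_and k b p q)))"
    unfolding bind_cont_def
    using wp_conjunctiveD[OF vf p' q'] B C
    by (intro valid_eq_lam[OF \<Gamma> a]) simp_all
  then have eq3: "valid sg \<Gamma> \<Phi> (EEq (EType 0) (EApp e (ELam (emb k a) ?B))
      (EApp e (bind_cont k a f (pred_and k b p q))))"
    using valid_eq_app[of sg \<Gamma> k SType0 "Suc 0" e "SArr a SType0", OF _ e lamB] T by simp
  have L: "typed sg \<Gamma> (EAnd (EApp e ?P) (EApp e ?Q)) (EType 0)"
    by (intro t_and typed_app_pred[OF e] P Q)
  show ?thesis
    by (rule valid_eq_trans[OF T L valid_eq_trans[OF T L eq1 eq2] eq3])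
qed

lemma wp_conjunctive_star_bind:
  assumes \<Gamma>: "declares_tyvars m k \<Gamma>" and a: "tyvars_below m a" and b: "tyvars_below m b"
    and e: "typed sg \<Gamma> e (emb k (wp_ty a))"
    and f: "typed sg (emb k a # \<Gamma>) f (emb (Suc k) (wp_ty b))"
    and ve: "valid sg \<Gamma> \<Phi> (wp_conjunctive k a e)"
    and vf: "valid sg (emb k a # \<Gamma>) (map lift \<Phi>) (wp_conjunctive (Suc k) b f)"
  shows "valid sg \<Gamma> \<Phi> (wp_conjunctive k b (star_bind k a b e f))"
proof -
  \<comment> \<open>The assumptions must be available below the two predicates that the goal
    quantifies. As hypotheses they are lifted by \<open>v_allI\<close>; since \<open>vf\<close>
    lives under the variable of the bind, it first has to be closed by \<open>EAll\<close>.\<close>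
  let ?p = "wp_conjunctive k a e" and ?q = "EAll (emb k a) (wp_conjunctive (Suc k) b f)"
  have \<Gamma>a: "declares_tyvars m (Suc k) (emb k a # \<Gamma>)" using \<Gamma> by simp
  have p: "typed sg \<Gamma> ?p (EType 0)"
    by (rule typed_wp_conjunctive[OF \<Gamma> a e])
  have q: "typed sg \<Gamma> ?q (EType 0)"
    by (rule typed_all_emb[OF \<Gamma> a typed_wp_conjunctive[OF \<Gamma>a b f]])
  have vq: "valid sg \<Gamma> (?p # \<Phi>) ?q"
  proof -
    obtain i where "typed sg \<Gamma> (emb k a) (EType i)"
      using typed_emb[OF \<Gamma> a] by blast
    then show ?thesis
      by (rule v_allI) (rule valid_mono[OF vf], auto)
  qed
  have "valid sg \<Gamma> (?q # ?p # \<Phi>) (wp_conjunctive k b (star_bind k a b e f))"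
  proof (rule wp_conjunctiveI[OF \<Gamma> b])
    let ?\<Gamma> = "emb (Suc k) (SArr b SType0) # emb k (SArr b SType0) # \<Gamma>"
    let ?k = "Suc (Suc k)"
    let ?e = "lift (lift e)" and ?f = "ren (up_ren Suc) (ren (up_ren Suc) f)"
    let ?\<Psi> = "map lift (map lift (?q # ?p # \<Phi>))"
    let ?w = "lift (lift (star_bind k a b e f))"
    let ?c = "bind_cont ?k a ?f"
    have \<Gamma>': "declares_tyvars m ?k ?\<Gamma>" using \<Gamma> by simp
    have v: "typed sg ?\<Gamma> (EVar 1) (emb ?k (SArr b SType0))"
      "typed sg ?\<Gamma> (EVar 0) (emb ?k (SArr b SType0))"
      by (simp_all only: One_nat_def typed_var1 typed_var0)
    note pq = typed_pred_and[OF \<Gamma>' b v]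
    have w: "typed sg ?\<Gamma> ?w (emb ?k (wp_ty b))"
      by (intro typed_lift_emb typed_star_bind[OF \<Gamma> a b e f])
    have e': "typed sg ?\<Gamma> ?e (emb ?k (wp_ty a))"
      by (intro typed_lift_emb e)
    have f': "typed sg (emb ?k a # ?\<Gamma>) ?f (emb (Suc ?k) (wp_ty b))"
      by (intro typed_up_Suc_emb f)
    have ve': "valid sg ?\<Gamma> ?\<Psi> (wp_conjunctive ?k a ?e)"
      by (rule v_hyp) simp
    \<comment> \<open>This is \<open>?q\<close> lifted three times, past both predicates and the
      variable of the continuation; instantiating it at that variable restores the open
      form.\<close>
    have "valid sg (emb ?k a # ?\<Gamma>) (map lift ?\<Psi>)
        (EAll (emb (Suc ?k) a) (wp_conjunctive (Suc (Suc ?k)) b (ren (up_ren Suc) ?f)))"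
      by (rule v_hyp) simp
    from v_allE[OF this typed_var0]
    have vf': "valid sg (emb ?k a # ?\<Gamma>) (map lift ?\<Psi>) (wp_conjunctive (Suc ?k) b ?f)"
      unfolding inst_wp_conjunctive unfolding inst_def inst_up_Suc_EVar0 .
    have conv: "conv (EApp ?w p) (EApp ?e (?c p))" for p
      by (simp add: conv_star_bind)
    have "valid sg ?\<Gamma> ?\<Psi> (EEq (EType 0) (EAnd (EApp ?e (?c (EVar 1))) (EApp ?e (?c (EVar 0))))
        (EApp ?e (?c (pred_and ?k b (EVar 1) (EVar 0)))))"
      by (rule bind_cont_pred_and[OF \<Gamma>' a b e' f' v ve' vf'])
    then show "valid sg ?\<Gamma> ?\<Psi> (EEq (EType 0) (EAnd (EApp ?w (EVar 1)) (EApp ?w (EVar 0)))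
        (EApp ?w (pred_and ?k b (EVar 1) (EVar 0))))"
      by (rule valid_conv)
        (intro cv_eq cv_and cv_refl cv_sym[OF conv] t_eq[OF t_type] t_and typed_app_pred[OF e']
          typed_app_pred[OF w] typed_bind_cont[OF \<Gamma>' a f'] v pq)+
  qed
  from valid_cut[OF p ve valid_cut[OF q vq this]] show ?thesis .
qed

section \<open>Functions, pairs and case analysis\<close>

lemma typed_case_emb:
  assumes \<Gamma>: "declares_tyvars m k \<Gamma>" and t: "tyvars_below m t"
    and e: "typed sg \<Gamma> e (emb k (SSum t1 t2))"
    and f1: "typed sg (emb k t1 # \<Gamma>) f1 (emb (Suc k) t)"
    and f2: "typed sg (emb k t2 # \<Gamma>) f2 (emb (Suc k) t)"
  shows "typed sg \<Gamma> (ECase e (emb k t1) f1 (emb k t2) f2) (emb k t)"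
proof -
  obtain i where "typed sg \<Gamma> (emb k t) (EType i)"
    using typed_emb[OF \<Gamma> t] by blast
  then show ?thesis
    using e f1 f2 by (auto intro: t_case)
qed

text \<open>The hole is the scrutinee. The formula is thereby carried from a case on
  \<open>a\<close>, which can reduce when \<open>a\<close> is an injection, back to the case on
  \<open>e\<close>.\<close>

lemma conjunctive_case_eq:
  assumes \<Gamma>: "declares_tyvars m k \<Gamma>" and t: "tyvars_below m t"
    and t12: "tyvars_below m t1" "tyvars_below m t2"
    and e: "typed sg \<Gamma> e (emb k (SSum t1 t2))"
    and f1: "typed sg (emb k t1 # \<Gamma>) f1 (emb (Suc k) t)"
    and f2: "typed sg (emb k t2 # \<Gamma>) f2 (emb (Suc k) t)"
    and eq: "valid sg \<Gamma> \<Phi> (EEq (emb k (SSum t1 t2)) e a)"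
    and a: "typed sg \<Gamma> a (emb k (SSum t1 t2))"
    and va: "valid sg \<Gamma> \<Phi> (conjunctive k t (ECase a (emb k t1) f1 (emb k t2) f2))"
  shows "valid sg \<Gamma> \<Phi> (conjunctive k t (ECase e (emb k t1) f1 (emb k t2) f2))"
proof -
  let ?s = "emb k (SSum t1 t2)"
  let ?p = "conjunctive (Suc k) t (ECase (EVar 0) (emb (Suc k) t1) (ren (up_ren Suc) f1)
      (emb (Suc k) t2) (ren (up_ren Suc) f2))"
  have \<Gamma>': "declares_tyvars m (Suc k) (?s # \<Gamma>)" using \<Gamma> by simp
  have p: "typed sg (?s # \<Gamma>) ?p (EType 0)"
    by (intro typed_conjunctive[OF \<Gamma>' t] typed_case_emb[OF \<Gamma>' t] typed_var0
        typed_up_Suc_emb f1 f2)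
  have "tyvars_below m (SSum t1 t2)" using t12 by simp
  then obtain i where "typed sg \<Gamma> ?s (EType i)"
    using typed_emb[OF \<Gamma>] by blast
  from valid_eq_sym[OF this e eq] have "valid sg \<Gamma> \<Phi> (EEq ?s a e)" .
  then show ?thesis
    by (rule valid_subst[OF _ p va]) (simp_all only: inst_conjunctive, simp_all add: inst_def)
qed

text \<open>By \<open>v_sum\<close> the scrutinee equals an injection of some \<open>x\<close>;
  replacing it by that injection lets the case reduce to a branch, whose conjunctivity is given. The
  formula is never opened, so all types \<open>t\<close> are treated alike.\<close>

lemma conjunctive_case:
  assumes \<Gamma>: "declares_tyvars m k \<Gamma>" and t: "tyvars_below m t"
    and t12: "tyvars_below m t1" "tyvars_below m t2"
    and e: "typed sg \<Gamma> e (emb k (SSum t1 t2))"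
    and f1: "typed sg (emb k t1 # \<Gamma>) f1 (emb (Suc k) t)"
    and f2: "typed sg (emb k t2 # \<Gamma>) f2 (emb (Suc k) t)"
    and v1: "valid sg (emb k t1 # \<Gamma>) (map lift \<Phi>) (conjunctive (Suc k) t f1)"
    and v2: "valid sg (emb k t2 # \<Gamma>) (map lift \<Phi>) (conjunctive (Suc k) t f2)"
  shows "valid sg \<Gamma> \<Phi> (conjunctive k t (ECase e (emb k t1) f1 (emb k t2) f2))"
proof -
  let ?case = "\<lambda>k e f1 f2. ECase e (emb k t1) f1 (emb k t2) f2"
  let ?f1 = "ren (up_ren Suc) f1" and ?f2 = "ren (up_ren Suc) f2"
  \<comment> \<open>Covers both sides: \<open>i\<close> is the injection of the new variable,
    \<open>f\<close> the branch, and \<open>\<Psi>\<close> the hypotheses present after the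
    eliminations.\<close>
  have branch: "valid sg (emb k s # \<Gamma>) \<Psi> (conjunctive (Suc k) t (?case (Suc k) (lift e) ?f1 ?f2))"
    if s: "typed sg (emb k s # \<Gamma>) i (emb (Suc k) (SSum t1 t2))"
      and eq: "EEq (emb (Suc k) (SSum t1 t2)) (lift e) i \<in> set \<Psi>"
      and f: "typed sg (emb k s # \<Gamma>) f (emb (Suc k) t)"
      and beta: "conv (?case (Suc k) i ?f1 ?f2) f"
      and v: "valid sg (emb k s # \<Gamma>) (map lift \<Phi>) (conjunctive (Suc k) t f)"
      and \<Psi>: "set (map lift \<Phi>) \<subseteq> set \<Psi>"
    for s i f and \<Psi>
  proof -
    let ?\<Gamma> = "emb k s # \<Gamma>"
    have \<Gamma>': "declares_tyvars m (Suc k) ?\<Gamma>" using \<Gamma> by simp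
    note typed = typed_lift_emb[OF e] typed_up_Suc_emb[OF f1] typed_up_Suc_emb[OF f2]
    have "valid sg ?\<Gamma> \<Psi> (conjunctive (Suc k) t (?case (Suc k) i ?f1 ?f2))"
      by (rule valid_conv[OF valid_mono[OF v \<Psi>]])
        (intro conv_conjunctive cv_sym[OF beta] typed_conjunctive[OF \<Gamma>' t] f
          typed_case_emb[OF \<Gamma>' t s] typed)+
    then show ?thesis
      by (intro conjunctive_case_eq[OF \<Gamma>' t t12 typed v_hyp[OF eq] s])
  qed
  have sum: "emb k (SSum t1 t2) = ESum (emb k t1) (emb k t2)" for k by simp
  have inl: "typed sg (emb k t1 # \<Gamma>) (EInl (EVar 0)) (emb (Suc k) (SSum t1 t2))"
    using typed_emb[OF declares_tyvars_Cons[OF \<Gamma>] t12(2)] typed_var0 unfolding sum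
    by (blast intro: t_inl)
  have inr: "typed sg (emb k t2 # \<Gamma>) (EInr (EVar 0)) (emb (Suc k) (SSum t1 t2))"
    using typed_emb[OF declares_tyvars_Cons[OF \<Gamma>] t12(1)] typed_var0 unfolding sum
    by (blast intro: t_inr)
  have beta: "conv (?case (Suc k) (EInl (EVar 0)) ?f1 ?f2) f1"
    "conv (?case (Suc k) (EInr (EVar 0)) ?f1 ?f2) f2"
    using cv_inl_beta[of "EVar 0" "emb (Suc k) t1" ?f1 "emb (Suc k) t2" ?f2]
      cv_inr_beta[of "EVar 0" "emb (Suc k) t1" ?f1 "emb (Suc k) t2" ?f2]
    by (simp_all add: inst_def)
  show ?thesis
  \<comment> \<open>Each disjunct becomes the head hypothesis and is eliminated at once, so the
    existential and its instance both end up among the hypotheses.\<close>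
  proof (rule v_orE[OF v_sum[OF e[unfolded sum]]]; rule v_exE[OF v_hyp[OF list.set_intros(1)]])
    let ?E = "EEx (emb k t1) (EEq (lift (ESum (emb k t1) (emb k t2))) (lift e) (EInl (EVar 0)))"
    show "valid sg (emb k t1 # \<Gamma>)
        (EEq (lift (ESum (emb k t1) (emb k t2))) (lift e) (EInl (EVar 0)) # map lift (?E # \<Phi>))
        (lift (conjunctive k t (?case k e f1 f2)))"
      unfolding lift_conjunctive ren.simps lift_emb
      by (rule branch[OF inl _ f1 beta(1) v1]) auto
  next
    let ?E = "EEx (emb k t2) (EEq (lift (ESum (emb k t1) (emb k t2))) (lift e) (EInr (EVar 0)))"
    show "valid sg (emb k t2 # \<Gamma>)
        (EEq (lift (ESum (emb k t1) (emb k t2))) (lift e) (EInr (EVar 0)) # map lift (?E # \<Phi>))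
        (lift (conjunctive k t (?case k e f1 f2)))"
      unfolding lift_conjunctive ren.simps lift_emb
      by (rule branch[OF inr _ f2 beta(2) v2]) auto
  qed
qed

text \<open>\<open>u \<noteq> SType0\<close> rules out the weakest-precondition clause, so the
  formula is \<open>ETrue\<close> or a quantified implication whose conclusion beta-reduces to the
  one about the body.\<close>

lemma conjunctive_lam:
  assumes \<Gamma>: "declares_tyvars m k \<Gamma>" and t: "tyvars_below m t" and u: "tyvars_below m u"
    and ne: "u \<noteq> SType0" and e: "typed sg (emb k t # \<Gamma>) e (emb (Suc k) u)"
    and v: "valid sg (emb k t # \<Gamma>) (conjunctive (Suc k) t (EVar 0) # map lift \<Phi>)
      (conjunctive (Suc k) u e)"
  shows "valid sg \<Gamma> \<Phi> (conjunctive k (SArr t u) (ELam (emb k t) e))"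
proof -
  let ?\<Gamma> = "emb k t # \<Gamma>"
  let ?app = "EApp (lift (ELam (emb k t) e)) (EVar 0)"
  have \<Gamma>': "declares_tyvars m (Suc k) ?\<Gamma>" using \<Gamma> by simp
  obtain i where ty: "typed sg \<Gamma> (emb k t) (EType i)"
    using typed_emb[OF \<Gamma> t] by blast
  have app: "typed sg ?\<Gamma> ?app (emb (Suc k) u)"
    by (rule typed_app_emb[OF typed_lift_emb[OF typed_lam_emb[OF \<Gamma> t e]] typed_var0])
  have "valid sg ?\<Gamma> (conjunctive (Suc k) t (EVar 0) # map lift \<Phi>) (conjunctive (Suc k) u ?app)"
    by (rule valid_conv[OF v])
      (intro conv_conjunctive cv_sym[OF conv_lam_lift_app] typed_conjunctive[OF \<Gamma>' u] e app)+
  then have "valid sg \<Gamma> \<Phi> (EAll (emb k t)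
      (EImp (conjunctive (Suc k) t (EVar 0)) (conjunctive (Suc k) u ?app)))"
    by (intro v_allI[OF ty] v_impI typed_conjunctive[OF \<Gamma>' t] typed_var0)
  then show ?thesis
    using ne by (simp add: v_trueI)
qed

lemma conjunctive_app:
  assumes ne: "u \<noteq> SType0" and e: "typed sg \<Gamma> e (emb k t)"
    and vf: "valid sg \<Gamma> \<Phi> (conjunctive k (SArr t u) f)"
    and ve: "valid sg \<Gamma> \<Phi> (conjunctive k t e)"
  shows "valid sg \<Gamma> \<Phi> (conjunctive k u (EApp f e))"
proof (cases "predicate_free (SArr t u)")
  case True
  \<comment> \<open>The formula of \<open>f\<close> carries no information here, but
    \<open>u\<close> is predicate-free too, so the goal is \<open>ETrue\<close>.\<close>
  then show ?thesis
    by (simp add: conjunctive_predicate_free v_trueI)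
next
  case False
  then have "valid sg \<Gamma> \<Phi> (EAll (emb k t) (EImp (conjunctive (Suc k) t (EVar 0))
      (conjunctive (Suc k) u (EApp (lift f) (EVar 0)))))"
    using vf ne by (auto split: if_splits)
  from v_allE[OF this e] have "valid sg \<Gamma> \<Phi> (EImp (inst (conjunctive (Suc k) t (EVar 0)) e)
      (inst (conjunctive (Suc k) u (EApp (lift f) (EVar 0))) e))"
    by (simp add: inst_def)
  then have "valid sg \<Gamma> \<Phi> (EImp (conjunctive k t e) (conjunctive k u (EApp f e)))"
    \<comment> \<open>\<open>inst_conjunctive\<close> matches on \<open>inst\<close>, so it must act
      before \<open>inst_def\<close> unfolds it.\<close>
    by (simp only: inst_conjunctive) (simp add: inst_def)
  then show ?thesis
    using ve by (rule v_impE)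
qed

lemma conjunctive_pair:
  assumes \<Gamma>: "declares_tyvars m k \<Gamma>" and tu: "tyvars_below m t" "tyvars_below m u"
    and a: "typed sg \<Gamma> a (emb k t)" and b: "typed sg \<Gamma> b (emb k u)"
    and va: "valid sg \<Gamma> \<Phi> (conjunctive k t a)" and vb: "valid sg \<Gamma> \<Phi> (conjunctive k u b)"
  shows "valid sg \<Gamma> \<Phi> (conjunctive k (SProd t u) (EPair a b))"
proof -
  have ab: "typed sg \<Gamma> (EPair a b) (EProd (emb k t) (emb k u))"
    using a b by (rule t_pair)
  have "valid sg \<Gamma> \<Phi> (conjunctive k t (EFst (EPair a b)))"
    by (rule valid_conv[OF va])
      (intro conv_conjunctive cv_sym[OF cv_fst_beta] typed_conjunctive[OF \<Gamma> tu(1)] a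
        t_fst[OF ab])+
  moreover have "valid sg \<Gamma> \<Phi> (conjunctive k u (ESnd (EPair a b)))"
    by (rule valid_conv[OF vb])
      (intro conv_conjunctive cv_sym[OF cv_snd_beta] typed_conjunctive[OF \<Gamma> tu(2)] b
        t_snd[OF ab])+
  ultimately show ?thesis
    by (simp add: v_andI v_trueI)
qed

lemma conjunctive_fst:
  "valid sg \<Gamma> \<Phi> (conjunctive k (SProd t u) e) \<Longrightarrow> valid sg \<Gamma> \<Phi> (conjunctive k t (EFst e))"
  by (auto simp: conjunctive_predicate_free v_trueI split: if_splits intro: v_andE1)

lemma conjunctive_snd:
  "valid sg \<Gamma> \<Phi> (conjunctive k (SProd t u) e) \<Longrightarrow> valid sg \<Gamma> \<Phi> (conjunctive k u (ESnd e))"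
  by (auto simp: conjunctive_predicate_free v_trueI split: if_splits intro: v_andE2)

section \<open>The translation of a derivation\<close>

fun comp_ty :: "eff \<Rightarrow> 'b ty \<Rightarrow> 'b sty" where
  "comp_ty EffN H = star_ty H"
| "comp_ty EffT A = wp_ty (star_ty A)"

fun wf_result :: "nat \<Rightarrow> eff \<Rightarrow> 'b ty \<Rightarrow> bool" where
  "wf_result m EffN H \<longleftrightarrow> wf_H m H"
| "wf_result m EffT A \<longleftrightarrow> wf_A m A"

lemma star_ty_TArr: "star_ty (TArr \<epsilon> H H') = SArr (star_ty H) (comp_ty \<epsilon> H')"
  by (cases \<epsilon>) simp_all

lemma star_ty_neq_SType0: "star_ty H \<noteq> SType0"
  by (cases H) (simp_all add: star_ty_TArr)

lemma comp_ty_neq_SType0: "comp_ty \<epsilon> H \<noteq> SType0"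
  by (cases \<epsilon>) (simp_all add: star_ty_neq_SType0)

lemma wf_H_TArr: "wf_H m (TArr \<epsilon> H H') \<Longrightarrow> wf_H m H \<and> wf_result m \<epsilon> H'"
  by (cases \<epsilon>) (auto simp: wf_H_def)

lemma wf_H_TProd: "wf_H m (TProd H H') \<Longrightarrow> wf_H m H \<and> wf_H m H'"
  by (auto simp: wf_H_def)

lemma wf_A_imp_wf_H: "wf_A m A \<Longrightarrow> wf_H m A"
  by (simp add: wf_H_def)

text \<open>Application, projections and case do not check their result type; its well-formedness is
  inherited from the arrow, the product or a branch.\<close>

lemma wf_result_star: "star sg m \<Gamma> e H \<epsilon> e' \<Longrightarrow> wf_result m \<epsilon> H"
  by (induction rule: star.induct) (auto dest: wf_H_TArr wf_H_TProd intro: wf_A_imp_wf_H)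

lemma tyvars_below_star_ty: "wf_H m H \<Longrightarrow> tyvars_below m (star_ty H)"
proof -
  have A: "wf_A m A \<Longrightarrow> tyvars_below m (star_ty A)" for m and A :: "'a ty"
    by (induction m A rule: wf_A.induct) auto
  have "wf_C m C \<Longrightarrow> tyvars_below m (star_ty C)" for C :: "'a ty"
    by (induction m C rule: wf_C.induct) (auto dest: A)
  then show "wf_H m H \<Longrightarrow> tyvars_below m (star_ty H)"
    using A by (auto simp: wf_H_def)
qed

lemma tyvars_below_comp_ty: "wf_result m \<epsilon> H \<Longrightarrow> tyvars_below m (comp_ty \<epsilon> H)"
  by (cases \<epsilon>) (auto simp: wf_H_def intro: tyvars_below_star_ty)

section \<open>Translated contexts, type preservation and the main induction\<close>

fun star_ctx :: "nat \<Rightarrow> 'b ty list \<Rightarrow> ('b, 'k) exp list" where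
  "star_ctx m [] = tyvar_ctx m"
| "star_ctx m (H # \<Gamma>) = emb (length \<Gamma>) (star_ty H) # star_ctx m \<Gamma>"

text \<open>Each formula is written where its variable is innermost. That variable itself counts
  among those declared after the type variables, hence the \<open>Suc\<close>.\<close>

fun conj_hyps :: "'b ty list \<Rightarrow> ('b, 'k) exp list" where
  "conj_hyps [] = []"
| "conj_hyps (H # \<Gamma>) = conjunctive (Suc (length \<Gamma>)) (star_ty H) (EVar 0) # map lift (conj_hyps \<Gamma>)"

lemma declares_tyvars_star_ctx: "declares_tyvars m (length \<Gamma>) (star_ctx m \<Gamma>)"
  by (induction \<Gamma>) (simp_all add: declares_tyvars_def tyvar_ctx_def)

lemma typed_star_ctx:
  "i < length \<Gamma> \<Longrightarrow> typed sg (star_ctx m \<Gamma>) (EVar i) (emb (length \<Gamma>) (star_ty (\<Gamma> ! i)))"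
proof (induction \<Gamma> arbitrary: i)
  case (Cons H \<Gamma>)
  show ?case
  proof (cases i)
    case 0
    then show ?thesis by (simp add: typed_var0)
  next
    case (Suc j)
    then show ?thesis
      using Cons.IH[of j] Cons.prems typed_lift_emb by fastforce
  qed
qed simp

lemma conj_hyps_nth:
  "i < length \<Gamma> \<Longrightarrow> conjunctive (length \<Gamma>) (star_ty (\<Gamma> ! i)) (EVar i) \<in> set (conj_hyps \<Gamma>)"
proof (induction \<Gamma> arbitrary: i)
  case (Cons H \<Gamma>)
  show ?case
  proof (cases i)
    case (Suc j)
    then show ?thesis
      using imageI[OF Cons.IH[of j], of lift] Cons.prems by simp
  qed simp
qed simp

text \<open>Type preservation is needed because rules such as \<open>v_allE\<close>,
  \<open>v_conv\<close> and \<open>v_sum\<close> accept only typed terms.\<close>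

lemma typed_star:
  "star sg m \<Gamma> e H \<epsilon> e' \<Longrightarrow> typed sg (star_ctx m \<Gamma>) e' (emb (length \<Gamma>) (comp_ty \<epsilon> H))"
proof (induction rule: star.induct)
  case (st_var i \<Gamma>)
  then show ?case by (simp add: typed_star_ctx)
next
  case (st_const \<kappa> bs b es es' \<Gamma>)
  then show ?case by (auto intro: t_const)
next
  case (st_lam H \<Gamma> e H' \<epsilon> e')
  then show ?case
    by (simp only: comp_ty.simps star_ty_TArr)
      (rule typed_lam_emb[OF declares_tyvars_star_ctx tyvars_below_star_ty], simp_all)
next
  case (st_app \<Gamma> f \<epsilon> H H' f' e e')
  then show ?case
    by (simp only: comp_ty.simps star_ty_TArr) (rule typed_app_emb)
next
  case (st_case \<Gamma> e A A' e' e1 H \<epsilon> e1' e2 e2')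
  then show ?case
    using tyvars_below_comp_ty[OF wf_result_star[OF st_case.hyps(4)]]
    by (intro typed_case_emb[OF declares_tyvars_star_ctx]) simp_all
next
  case (st_return \<Gamma> e A e')
  then show ?case
    using typed_star_return[OF declares_tyvars_star_ctx, of m "star_ty A" sg \<Gamma> e']
    by (simp add: star_return_def wf_H_def tyvars_below_star_ty)
next
  case (st_bind \<Gamma> e1 A e1' e2 A' e2')
  then show ?case
    using typed_star_bind[OF declares_tyvars_star_ctx, of m "star_ty A" "star_ty A'" sg \<Gamma> e1' e2']
    by (simp add: star_bind_def wf_H_def tyvars_below_star_ty)
next
  case (st_inl \<Gamma> e A e' A')
  then show ?case
    using typed_emb[OF declares_tyvars_star_ctx, of m "star_ty A'" sg \<Gamma>]
    by (auto simp: wf_H_def tyvars_below_star_ty intro: t_inl)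
next
  case (st_inr \<Gamma> e A' e' A)
  then show ?case
    using typed_emb[OF declares_tyvars_star_ctx, of m "star_ty A" sg \<Gamma>]
    by (auto simp: wf_H_def tyvars_below_star_ty intro: t_inr)
qed (auto intro: t_pair t_fst t_snd)

text \<open>A bound variable of type \<open>A\<close> adds only \<open>ETrue\<close> to
  \<open>conj_hyps\<close>. The rules for case and bind leave no room for a hypothesis about it, so
  it is removed here.\<close>

lemma valid_discharge_true:
  assumes "valid sg \<Gamma> (ETrue # \<Phi>) p" shows "valid sg \<Gamma> \<Phi> p"
  by (rule valid_cut[OF t_true v_trueI assms])

lemma conjunctive_star:
  "star sg m \<Gamma> e H \<epsilon> e' \<Longrightarrow>
   valid sg (star_ctx m \<Gamma>) (conj_hyps \<Gamma>) (conjunctive (length \<Gamma>) (comp_ty \<epsilon> H) e')"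
proof (induction rule: star.induct)
  case (st_var i \<Gamma>)
  then show ?case by (simp add: v_hyp conj_hyps_nth)
next
  case (st_const \<kappa> bs b es es' \<Gamma>)
  then show ?case by (simp add: v_trueI)
next
  case (st_lam H \<Gamma> e H' \<epsilon> e')
  then have "typed sg (star_ctx m (H # \<Gamma>)) e' (emb (length (H # \<Gamma>)) (comp_ty \<epsilon> H'))"
    using typed_star by blast
  moreover have "wf_H m H" "wf_result m \<epsilon> H'"
    using st_lam.hyps wf_H_TArr by blast+
  ultimately show ?case
    using st_lam.IH unfolding comp_ty.simps star_ty_TArr
    by (intro conjunctive_lam[OF declares_tyvars_star_ctx tyvars_below_star_ty
        tyvars_below_comp_ty comp_ty_neq_SType0]) simp_all
next
  case (st_app \<Gamma> f \<epsilon> H H' f' e e')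
  show ?case
    using conjunctive_app[OF comp_ty_neq_SType0] typed_star[OF st_app.hyps(2)] st_app.IH
    unfolding comp_ty.simps star_ty_TArr by blast
next
  case (st_pair \<Gamma> e1 H e1' e2 H' e2')
  have "wf_H m H" "wf_H m H'"
    using st_pair.hyps(3) wf_H_TProd by blast+
  then show ?case
    using typed_star[OF st_pair.hyps(1)] typed_star[OF st_pair.hyps(2)] st_pair.IH
    unfolding comp_ty.simps star_ty.simps
    by (intro conjunctive_pair[OF declares_tyvars_star_ctx tyvars_below_star_ty
        tyvars_below_star_ty])
next
  case (st_fst \<Gamma> e H H' e')
  then show ?case
    unfolding comp_ty.simps star_ty.simps by (intro conjunctive_fst)
next
  case (st_snd \<Gamma> e H H' e')
  then show ?case
    unfolding comp_ty.simps star_ty.simps by (intro conjunctive_snd)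
next
  case (st_inl \<Gamma> e A e' A')
  \<comment> \<open>Both summands are well-formed \<open>A\<close> types, so the formula of the sum
    is \<open>ETrue\<close> and not the default \<open>EFalse\<close>.\<close>
  then show ?case by (simp add: predicate_free_star_ty v_trueI)
next
  case (st_inr \<Gamma> e A' e' A)
  then show ?case by (simp add: predicate_free_star_ty v_trueI)
next
  case (st_case \<Gamma> e A A' e' e1 H \<epsilon> e1' e2 e2')
  have "valid sg (star_ctx m (A # \<Gamma>)) (map lift (conj_hyps \<Gamma>))
      (conjunctive (Suc (length \<Gamma>)) (comp_ty \<epsilon> H) e1')"
    "valid sg (star_ctx m (A' # \<Gamma>)) (map lift (conj_hyps \<Gamma>))
      (conjunctive (Suc (length \<Gamma>)) (comp_ty \<epsilon> H) e2')"
    using st_case.IH(2,3) st_case.hyps(2,3)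
    by (auto simp: conjunctive_predicate_free predicate_free_star_ty intro: valid_discharge_true)
  then show ?case
    using typed_star[OF st_case.hyps(1)] typed_star[OF st_case.hyps(4)]
      typed_star[OF st_case.hyps(5)] tyvars_below_comp_ty[OF wf_result_star[OF st_case.hyps(4)]]
      st_case.hyps(2,3)
    by (intro conjunctive_case[OF declares_tyvars_star_ctx])
      (simp_all add: wf_H_def tyvars_below_star_ty)
next
  case (st_return \<Gamma> e A e')
  have "tyvars_below m (star_ty A)"
    using st_return.hyps by (simp add: wf_H_def tyvars_below_star_ty)
  \<comment> \<open>That \<open>star_ty A\<close> is predicate-free is what makes
    \<open>conjunctive\<close> select the weakest-precondition clause at
    \<open>comp_ty EffT A\<close>.\<close>
  from wp_conjunctive_star_return[OF declares_tyvars_star_ctx this, of sg \<Gamma> e'] show ?case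
    using typed_star[OF st_return.hyps(1)] st_return.hyps(2)
    by (simp add: star_return_def predicate_free_star_ty)
next
  case (st_bind \<Gamma> e1 A e1' e2 A' e2')
  have below: "tyvars_below m (star_ty A)" "tyvars_below m (star_ty A')"
    using st_bind.hyps by (simp_all add: wf_H_def tyvars_below_star_ty)
  have pf: "predicate_free (star_ty A)" "predicate_free (star_ty A')"
    using st_bind.hyps by (simp_all add: predicate_free_star_ty)
  have "valid sg (star_ctx m (A # \<Gamma>)) (map lift (conj_hyps \<Gamma>))
      (wp_conjunctive (Suc (length \<Gamma>)) (star_ty A') e2')"
    using st_bind.IH(2) pf
    by (auto simp: conjunctive_predicate_free intro: valid_discharge_true)
  with wp_conjunctive_star_bind[OF declares_tyvars_star_ctx below, of sg \<Gamma> e1' e2'] show ?case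
    using typed_star[OF st_bind.hyps(1)] typed_star[OF st_bind.hyps(3)] st_bind.IH(1) pf
    by (simp add: star_bind_def)
qed

text \<open>As the translation is a relation, conjunctivity is claimed for all translations of
  \<open>e\<close>, and the first conjunct excludes vacuity. In the empty context
  \<open>conj_hyps\<close> is empty, so no assumption about variables remains.\<close>

theorem theorem8:
  fixes sg :: "'k \<Rightarrow> 'b list \<times> 'b" and m :: nat and e :: "('b, 'k) tm" and C :: "'b ty"
  assumes "wf_C m C"
    and "typing sg m [] e C EffN"
  shows "(\<exists>e'. star sg m [] e C EffN e') \<and>
    (\<forall>e'. star sg m [] e C EffN e' \<longrightarrow>
      valid sg (tyvar_ctx m) [] (conjunctive 0 (star_ty C) e'))"
  using assms(2) conjunctive_star[of sg m "[]" e C EffN] by (auto simp: typing_iff_star)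

end
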